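(* Let $d\ge 2$, let $Y\in\mathcal{M}_{\mathbf r}\subset\mathbb{R}^{n_1\times\cdots\times n_d}$, and let $\mathbf Y^{\langle k\rangle}=\mathbf U_{\le k}\mathbf S_k\mathbf V_{>k}^{\top}$, $k=1,\dots,d-1$, be the orthogonal decompositions of its unfolding matrices described in the context. For $k=1,\dots,d-1$ let $\mathbf X_{\le k}\in\mathbb{R}^{(n_1\cdots n_k)\times r_k}$ and $\mathbf X_{>k}\in\mathbb{R}^{(n_{k+1}\cdots n_d)\times r_k}$ be matrices such that $\mathbf X_{\le k}^{\top}\mathbf U_{\le k}$ and $\mathbf X_{>k}^{\top}\mathbf V_{>k}$ are invertible, and let $P_{\le k},P_{>k}$ be the associated linear operators on $\mathbb{R}^{n_1\times\cdots\times n_d}$ defined in the context. Then the map $$P_Y=\sum_{k=1}^{d-1}\bigl(P_{\le k-1}P_{>k}-P_{\le k}P_{>k}\bigr)+P_{\le d-1},\qquad P_{\le 0}=1,$$ defined on all tensors $Z\in\mathbb{R}^{n_1\times\cdots\times n_d}$, is an oblique projector onto the tangent space $T_Y\mathcal{M}_{\mathbf r}$.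
   Context: Unfoldings: for $Z\in\mathbb{R}^{n_1\times\cdots\times n_d}$, $\mathbf Z^{\langle k\rangle}\in\mathbb{R}^{(n_1\cdots n_k)\times(n_{k+1}\cdots n_d)}$ is the matrix with rows indexed by $(i_1,\dots,i_k)$ and columns indexed by $(i_{k+1},\dots,i_d)$, both ordered colexicographically. $\mathrm{Ten}_k$ is the inverse operation: $\mathrm{Ten}_k(\mathbf Z^{\langle k\rangle})=Z$. TT-rank and manifold: the TT-rank of $Y$ is $\mathbf r=(1,r_1,\dots,r_{d-1},1)$ with $r_k=\operatorname{rank}\mathbf Y^{\langle k\rangle}$ (so $r_0=r_d=1$). $\mathcal{M}_{\mathbf r}=\{Y\in\mathbb{R}^{n_1\times\cdots\times n_d}:\text{TT-rank}(Y)=\mathbf r\}$, a smooth embedded submanifold of $\mathbb{R}^{n_1\times\cdots\times n_d}$. If $Y(i_1,\dots,i_d)=C_1(i_1)\cdots C_d(i_d)$ with TT-cores $C_k\in\mathbb{R}^{r_{k-1}\times n_k\times r_k}$ (where $C_k(i_k)$ is an $r_{k-1}\times r_k$ matrix), the tangent space $T_Y\mathcal{M}_{\mathbf r}$ consists of the tensors $\delta C_1C_2\cdots C_d+C_1\delta C_2C_3\cdots C_d+\cdots+C_1\cdots C_{d-1}\delta C_d$ with arbitrary $\delta C_k\in\mathbb{R}^{r_{k-1}\times n_k\times r_k}$. Orthogonal decompositions: $U_1,\dots,U_{d-1}$ are left-orthogonal TT-cores and $V_2,\dots,V_d$ right-orthogonal TT-cores of $Y$ ($U_k,V_k\in\mathbb{R}^{r_{k-1}\times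 n_k\times r_k}$; left-orthogonal means the $r_{k-1}n_k\times r_k$ reshaping of $U_k$ has orthonormal columns, right-orthogonal means the $r_{k-1}\times n_kr_k$ reshaping of $V_k$ has orthonormal rows), such that for every $k=1,\dots,d-1$, $Y(i_1,\dots,i_d)=U_1(i_1)\cdots U_k(i_k)\,\mathbf S_k\,V_{k+1}(i_{k+1})\cdots V_d(i_d)$ with $\mathbf S_k\in\mathbb{R}^{r_k\times r_k}$ invertible. The matrices $\mathbf U_{\le k}\in\mathbb{R}^{(n_1\cdots n_k)\times r_k}$ and $\mathbf V_{>k}\in\mathbb{R}^{(n_{k+1}\cdots n_d)\times r_k}$ have rows $\mathbf U_{\le k}(i_1\cdots i_k,:)=U_1(i_1)\cdots U_k(i_k)$ and $\mathbf V_{>k}(i_{k+1}\cdots i_d,:)=\bigl(V_{k+1}(i_{k+1})\cdots V_d(i_d)\bigr)^{\top}$; their columns are orthonormal bases of the range and co-range of $\mathbf Y^{\langle k\rangle}$, and $\mathbf Y^{\langle k\rangle}=\mathbf U_{\le k}\mathbf S_k\mathbf V_{>k}^{\top}$. Oblique projectors: $\mathbf P_{\le k}=\mathbf U_{\le k}(\mathbf X_{\le k}^{\top}\mathbf U_{\le k})^{-1}\mathbf X_{\le k}^{\top}$ and $\mathbf P_{>k}=\mathbf X_{>k}(\mathbf X_{>k}^{\top}\mathbf V_{>k})^{-\top}\mathbf V_{>k}^{\top}$; on tensors, $P_{\le k}Z=\mathrm{Ten}_k[\mathbf P_{\le k}\mathbf Z^{\langle k\rangle}]$ and $P_{>k}Z=\mathrm{Ten}_k[\mathbf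 Z^{\langle k\rangle}\mathbf P_{>k}]$. "Oblique projector onto a subspace $W$" means an idempotent linear map with image $W$ (not necessarily orthogonal). *)

theory Defs
  imports
    Complex_Main
    "HOL-Library.FuncSet"
    "Jordan_Normal_Form.Matrix"
    "Jordan_Normal_Form.Gauss_Jordan_Elimination"
    "Jordan_Normal_Form.DL_Rank"
begin

text \<open>
  The modes are numbered 1, ..., d and mode k has size \<open>n k\<close>, with index values
  \<open>0, ..., n k - 1\<close>. A tensor is a function on multi-indices that vanishes outside the
  index set, so that equality of tensors is equality of functions.
\<close>

type_synonym multi_index = "nat \<Rightarrow> nat"
type_synonym tensor = "multi_index \<Rightarrow> real"

definition index_set :: "(nat \<Rightarrow> nat) \<Rightarrow> nat \<Rightarrow> multi_index set" where
  "index_set n d = (\<Pi>\<^sub>E k\<in>{1..d}. {..<n k})"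

definition tensor_space :: "(nat \<Rightarrow> nat) \<Rightarrow> nat \<Rightarrow> tensor set" where
  "tensor_space n d = {Z. \<forall>i. i \<notin> index_set n d \<longrightarrow> Z i = 0}"

text \<open>
  \<open>colex n a b i\<close> is the position of \<open>(i (a+1), ..., i b)\<close> in the colexicographic order (the
  first index varies fastest), counted from 0; \<open>colex_inv n a c j\<close> recovers the component
  \<open>i j\<close>, for \<open>j > a\<close>, from the position \<open>c\<close>.
\<close>

definition num_indices :: "(nat \<Rightarrow> nat) \<Rightarrow> nat \<Rightarrow> nat \<Rightarrow> nat" where
  "num_indices n a b = (\<Prod>j\<in>{a<..b}. n j)"

definition colex :: "(nat \<Rightarrow> nat) \<Rightarrow> nat \<Rightarrow> nat \<Rightarrow> multi_index \<Rightarrow> nat" where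
  "colex n a b i = (\<Sum>j\<in>{a<..b}. i j * num_indices n a (j - 1))"

definition colex_inv :: "(nat \<Rightarrow> nat) \<Rightarrow> nat \<Rightarrow> nat \<Rightarrow> multi_index" where
  "colex_inv n a c = (\<lambda>j. (c div num_indices n a (j - 1)) mod n j)"

definition join_index ::
  "(nat \<Rightarrow> nat) \<Rightarrow> nat \<Rightarrow> nat \<Rightarrow> nat \<Rightarrow> nat \<Rightarrow> multi_index" where
  "join_index n d k a b =
     (\<lambda>j\<in>{1..d}. if j \<le> k then colex_inv n 0 a j else colex_inv n k b j)"

definition unfolding_mat :: "(nat \<Rightarrow> nat) \<Rightarrow> nat \<Rightarrow> nat \<Rightarrow> tensor \<Rightarrow> real mat" where
  "unfolding_mat n d k Z =
     mat (num_indices n 0 k) (num_indices n k d) (\<lambda>(a, b). Z (join_index n d k a b))"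

definition Ten :: "(nat \<Rightarrow> nat) \<Rightarrow> nat \<Rightarrow> nat \<Rightarrow> real mat \<Rightarrow> tensor" where
  "Ten n d k M =
     (\<lambda>i. if i \<in> index_set n d then M $$ (colex n 0 k i, colex n k d i) else 0)"

lemma greaterThanAtMost_Suc: "a \<le> b \<Longrightarrow> {a<..Suc b} = insert (Suc b) {a<..b}"
  by auto

lemma num_indices_Suc:
  "a \<le> b \<Longrightarrow> num_indices n a (Suc b) = num_indices n a b * n (Suc b)"
  by (simp add: num_indices_def greaterThanAtMost_Suc)

lemma colex_Suc:
  "a \<le> b \<Longrightarrow> colex n a (Suc b) i = colex n a b i + i (Suc b) * num_indices n a b"
  by (simp add: colex_def greaterThanAtMost_Suc)

lemma colex_less:
  assumes "a \<le> b" "\<forall>j\<in>{a<..b}. i j < n j"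
  shows "colex n a b i < num_indices n a b"
  using assms
proof (induction b rule: dec_induct)
  case base
  show ?case by (simp add: colex_def num_indices_def)
next
  case (step b)
  have "colex n a b i + i (Suc b) * num_indices n a b < Suc (i (Suc b)) * num_indices n a b"
    using step by simp
  also have "\<dots> \<le> n (Suc b) * num_indices n a b"
    using step by (intro mult_right_mono) (auto simp: Suc_le_eq)
  finally show ?case
    using step by (simp add: colex_Suc num_indices_Suc mult.commute)
qed

lemma colex_inv_colex:
  assumes "a \<le> b" "\<forall>j\<in>{a<..b}. i j < n j" "j \<in> {a<..b}"
  shows "colex_inv n a (colex n a b i) j = i j"
  using assms
proof (induction b rule: dec_induct)
  case base
  then show ?case by simp
next
  case (step b)
  have less: "colex n a b i < num_indices n a b"
    using step by (intro colex_less) auto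
  show ?case
  proof (cases "j = Suc b")
    case True
    then show ?thesis
      using step less by (simp add: colex_inv_def colex_Suc)
  next
    case False
    then have j: "a < j" "j \<le> b"
      using step.prems by auto
    define M where "M = num_indices n a (j - 1)"
    define R where "R = num_indices n j b"
    have "{a<..b} = {a<..j} \<union> {j<..b}"
      using j by auto
    then have "num_indices n a b = num_indices n a j * R"
      by (simp add: num_indices_def R_def prod.union_disjoint)
    also have "num_indices n a j = M * n j"
      using num_indices_Suc [of a "j - 1" n] j by (simp add: M_def)
    finally have eq: "num_indices n a b = M * (n j * R)"
      by simp
    then have "M > 0"
      using less by (cases "M = 0") auto
    have "i (Suc b) * num_indices n a b = M * (n j * (R * i (Suc b)))"
      by (simp only: eq ac_simps)
    then have "colex n a (Suc b) i = colex n a b i + M * (n j * (R * i (Suc b)))"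
      using step.hyps by (simp only: colex_Suc)
    then have "colex_inv n a (colex n a (Suc b) i) j = colex_inv n a (colex n a b i) j"
      using \<open>M > 0\<close> by (simp add: colex_inv_def M_def [symmetric, simplified])
    then show ?thesis
      using step j by auto
  qed
qed

lemma Ten_unfolding_mat:
  assumes "Z \<in> tensor_space n d" "k \<le> d"
  shows "Ten n d k (unfolding_mat n d k Z) = Z"
proof
  fix i
  show "Ten n d k (unfolding_mat n d k Z) i = Z i"
  proof (cases "i \<in> index_set n d")
    case True
    then have *: "\<forall>j\<in>{0<..k}. i j < n j" "\<forall>j\<in>{k<..d}. i j < n j"
      using assms by (auto simp: index_set_def)
    have "join_index n d k (colex n 0 k i) (colex n k d i) = i"
    proof
      fix j
      consider "j \<notin> {1..d}" | "j \<in> {1..d}" "j \<in> {0<..k}" | "j \<in> {1..d}" "j \<in> {k<..d}"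
        by force
      then show "join_index n d k (colex n 0 k i) (colex n k d i) j = i j"
      proof cases
        case 1
        then show ?thesis
          using PiE_arb [OF True [unfolded index_set_def] 1] by (auto simp: join_index_def)
      next
        case 2
        then show ?thesis
          using colex_inv_colex [OF _ *(1), of j] by (simp add: join_index_def)
      next
        case 3
        then show ?thesis
          using colex_inv_colex [OF assms(2) *(2), of j] by (simp add: join_index_def)
      qed
    qed
    moreover have "colex n 0 k i < num_indices n 0 k" "colex n k d i < num_indices n k d"
      using colex_less [OF _ *(1)] colex_less [OF assms(2) *(2)] by simp_all
    ultimately show ?thesis
      using True by (simp add: Ten_def unfolding_mat_def)
  next
    case False
    then show ?thesis
      using assms by (simp add: Ten_def tensor_space_def)
  qed
qed

definition tt_rank :: "(nat \<Rightarrow> nat) \<Rightarrow> nat \<Rightarrow> tensor \<Rightarrow> nat \<Rightarrow> nat" where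
  "tt_rank n d Y k =
     (if 1 \<le> k \<and> k < d then vec_space.rank (num_indices n 0 k) (unfolding_mat n d k Y) else 1)"

definition tt_manifold :: "(nat \<Rightarrow> nat) \<Rightarrow> nat \<Rightarrow> (nat \<Rightarrow> nat) \<Rightarrow> tensor set" where
  "tt_manifold n d r = {Y \<in> tensor_space n d. \<forall>k\<le>d. tt_rank n d Y k = r k}"

text \<open>A TT-core of mode \<open>k\<close> is the family of its slices \<open>C 0, ..., C (n k - 1)\<close>.\<close>

type_synonym core = "nat \<Rightarrow> real mat"

definition is_core :: "(nat \<Rightarrow> nat) \<Rightarrow> (nat \<Rightarrow> nat) \<Rightarrow> nat \<Rightarrow> core \<Rightarrow> bool" where
  "is_core n r k C \<longleftrightarrow> (\<forall>i<n k. C i \<in> carrier_mat (r (k - 1)) (r k))"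

text \<open>\<open>core_prod r C i a b\<close> is the product of the slices \<open>C j (i j)\<close> over \<open>j = a+1, ..., b\<close>.\<close>

fun core_prod ::
  "(nat \<Rightarrow> nat) \<Rightarrow> (nat \<Rightarrow> core) \<Rightarrow> multi_index \<Rightarrow> nat \<Rightarrow> nat \<Rightarrow> real mat" where
  "core_prod r C i a 0 = 1\<^sub>m (r a)"
| "core_prod r C i a (Suc b) =
     (if a \<le> b then core_prod r C i a b * C (Suc b) (i (Suc b)) else 1\<^sub>m (r a))"

definition tt_tensor ::
  "(nat \<Rightarrow> nat) \<Rightarrow> nat \<Rightarrow> (nat \<Rightarrow> nat) \<Rightarrow> (nat \<Rightarrow> core) \<Rightarrow> tensor" where
  "tt_tensor n d r C =
     (\<lambda>i. if i \<in> index_set n d then core_prod r C i 0 d $$ (0, 0) else 0)"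

definition tt_representation ::
  "(nat \<Rightarrow> nat) \<Rightarrow> nat \<Rightarrow> (nat \<Rightarrow> nat) \<Rightarrow> tensor \<Rightarrow> (nat \<Rightarrow> core) \<Rightarrow> bool" where
  "tt_representation n d r Y C \<longleftrightarrow>
     (\<forall>k\<in>{1..d}. is_core n r k (C k)) \<and> Y = tt_tensor n d r C"

text \<open>
  The tangent space of the manifold at the tensor with TT-cores \<open>C\<close>: the \<open>k\<close>-th summand has
  the core \<open>C k\<close> replaced by an arbitrary core \<open>D k\<close> of the same size.
\<close>

definition tt_tangent_space ::
  "(nat \<Rightarrow> nat) \<Rightarrow> nat \<Rightarrow> (nat \<Rightarrow> nat) \<Rightarrow> (nat \<Rightarrow> core) \<Rightarrow> tensor set" where
  "tt_tangent_space n d r C =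
     {Z. \<exists>D. (\<forall>k\<in>{1..d}. is_core n r k (D k)) \<and>
             Z = (\<lambda>i. \<Sum>k = 1..d. tt_tensor n d r (C(k := D k)) i)}"

text \<open>The reshapings merge indices colexicographically, as in the unfoldings.\<close>

definition left_reshape :: "(nat \<Rightarrow> nat) \<Rightarrow> (nat \<Rightarrow> nat) \<Rightarrow> nat \<Rightarrow> core \<Rightarrow> real mat" where
  "left_reshape n r k C =
     mat (r (k - 1) * n k) (r k) (\<lambda>(a, b). C (a div r (k - 1)) $$ (a mod r (k - 1), b))"

definition right_reshape :: "(nat \<Rightarrow> nat) \<Rightarrow> (nat \<Rightarrow> nat) \<Rightarrow> nat \<Rightarrow> core \<Rightarrow> real mat" where
  "right_reshape n r k C =
     mat (r (k - 1)) (n k * r k) (\<lambda>(a, b). C (b mod n k) $$ (a, b div n k))"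

definition left_orthogonal :: "(nat \<Rightarrow> nat) \<Rightarrow> (nat \<Rightarrow> nat) \<Rightarrow> nat \<Rightarrow> core \<Rightarrow> bool" where
  "left_orthogonal n r k C \<longleftrightarrow>
     (left_reshape n r k C)\<^sup>T * left_reshape n r k C = 1\<^sub>m (r k)"

definition right_orthogonal :: "(nat \<Rightarrow> nat) \<Rightarrow> (nat \<Rightarrow> nat) \<Rightarrow> nat \<Rightarrow> core \<Rightarrow> bool" where
  "right_orthogonal n r k C \<longleftrightarrow>
     right_reshape n r k C * (right_reshape n r k C)\<^sup>T = 1\<^sub>m (r (k - 1))"

definition orthogonal_decomposition ::
  "(nat \<Rightarrow> nat) \<Rightarrow> nat \<Rightarrow> (nat \<Rightarrow> nat) \<Rightarrow> tensor \<Rightarrow>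
   (nat \<Rightarrow> core) \<Rightarrow> (nat \<Rightarrow> core) \<Rightarrow> (nat \<Rightarrow> real mat) \<Rightarrow> bool" where
  "orthogonal_decomposition n d r Y U V S \<longleftrightarrow>
     (\<forall>k\<in>{1..d-1}. is_core n r k (U k) \<and> left_orthogonal n r k (U k)) \<and>
     (\<forall>k\<in>{2..d}. is_core n r k (V k) \<and> right_orthogonal n r k (V k)) \<and>
     (\<forall>k\<in>{1..d-1}. S k \<in> carrier_mat (r k) (r k) \<and> invertible_mat (S k) \<and>
        (\<forall>i\<in>index_set n d.
           Y i = (core_prod r U i 0 k * S k * core_prod r V i k d) $$ (0, 0)))"

definition le_mat ::
  "(nat \<Rightarrow> nat) \<Rightarrow> (nat \<Rightarrow> nat) \<Rightarrow> (nat \<Rightarrow> core) \<Rightarrow> nat \<Rightarrow> real mat" where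
  "le_mat n r U k =
     mat (num_indices n 0 k) (r k) (\<lambda>(a, b). core_prod r U (colex_inv n 0 a) 0 k $$ (0, b))"

definition gt_mat ::
  "(nat \<Rightarrow> nat) \<Rightarrow> nat \<Rightarrow> (nat \<Rightarrow> nat) \<Rightarrow> (nat \<Rightarrow> core) \<Rightarrow> nat \<Rightarrow> real mat" where
  "gt_mat n d r V k =
     mat (num_indices n k d) (r k) (\<lambda>(a, b). core_prod r V (colex_inv n k a) k d $$ (b, 0))"

text \<open>Only meaningful for invertible \<open>A\<close>, for which \<open>mat_inverse A\<close> is not \<open>None\<close>.\<close>

definition inv_mat :: "real mat \<Rightarrow> real mat" where
  "inv_mat A = the (mat_inverse A)"

definition proj_le_mat :: "real mat \<Rightarrow> real mat \<Rightarrow> real mat" where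
  "proj_le_mat U X = U * inv_mat (X\<^sup>T * U) * X\<^sup>T"

definition proj_gt_mat :: "real mat \<Rightarrow> real mat \<Rightarrow> real mat" where
  "proj_gt_mat V X = X * (inv_mat (X\<^sup>T * V))\<^sup>T * V\<^sup>T"

text \<open>The case \<open>k = 0\<close> is by convention the identity.\<close>

definition P_le ::
  "(nat \<Rightarrow> nat) \<Rightarrow> nat \<Rightarrow> (nat \<Rightarrow> nat) \<Rightarrow> (nat \<Rightarrow> core) \<Rightarrow> (nat \<Rightarrow> real mat) \<Rightarrow>
   nat \<Rightarrow> tensor \<Rightarrow> tensor" where
  "P_le n d r U X k Z =
     (if k = 0 then Z
      else Ten n d k (proj_le_mat (le_mat n r U k) (X k) * unfolding_mat n d k Z))"

definition P_gt ::
  "(nat \<Rightarrow> nat) \<Rightarrow> nat \<Rightarrow> (nat \<Rightarrow> nat) \<Rightarrow> (nat \<Rightarrow> core) \<Rightarrow> (nat \<Rightarrow> real mat) \<Rightarrow>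
   nat \<Rightarrow> tensor \<Rightarrow> tensor" where
  "P_gt n d r V X k Z =
     Ten n d k (unfolding_mat n d k Z * proj_gt_mat (gt_mat n d r V k) (X k))"

definition P_tangent ::
  "(nat \<Rightarrow> nat) \<Rightarrow> nat \<Rightarrow> (nat \<Rightarrow> nat) \<Rightarrow> (nat \<Rightarrow> core) \<Rightarrow> (nat \<Rightarrow> core) \<Rightarrow>
   (nat \<Rightarrow> real mat) \<Rightarrow> (nat \<Rightarrow> real mat) \<Rightarrow> tensor \<Rightarrow> tensor" where
  "P_tangent n d r U V Xle Xgt Z =
     (\<lambda>i. (\<Sum>k = 1..d-1.
             P_le n d r U Xle (k - 1) (P_gt n d r V Xgt k Z) i
             - P_le n d r U Xle k (P_gt n d r V Xgt k Z) i)
          + P_le n d r U Xle (d - 1) Z i)"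

definition oblique_projector_onto ::
  "tensor set \<Rightarrow> (tensor \<Rightarrow> tensor) \<Rightarrow> tensor set \<Rightarrow> bool" where
  "oblique_projector_onto E P W \<longleftrightarrow>
     (\<forall>Z\<in>E. P Z \<in> E) \<and>
     (\<forall>Z\<in>E. \<forall>Z'\<in>E. \<forall>a b. P (\<lambda>i. a * Z i + b * Z' i) = (\<lambda>i. a * P Z i + b * P Z' i)) \<and>
     (\<forall>Z\<in>E. P (P Z) = P Z) \<and>
     P ` E = W"

end

theory Submission
  imports Defs
begin

text \<open>
  The matrices \<open>inv_mat (X\<^sup>T * U) * X\<^sup>T\<close> are left inverses of the frames \<open>U\<close> and \<open>V\<close>, and this is
  all that is used of the frames. Nestedness of the TT-cores gives \<open>P_le j (P_le k Z) = P_le k Z\<close> and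
  \<open>P_gt k (P_gt j Z) = P_gt j Z\<close> for \<open>j \<le> k\<close>, and \<open>P_le j\<close> commutes with \<open>P_gt k\<close>
  for \<open>j \<le> k\<close> because they act on disjoint groups of indices. Hence on the tensors fixed by
  \<open>P_le (j - 1)\<close> and \<open>P_gt j\<close> the summands with \<open>k < j\<close> vanish and the remaining ones
  telescope to the identity, while each summand of the projector takes values in such a space. These
  spaces are the summands of the tangent space: two factorizations of the same unfolding with inner
  dimension \<open>r k\<close> differ by an invertible matrix, which can be absorbed into the free core.
\<close>

section \<open>Matrix algebra: entries of products, inverses, factorizations\<close>

lemma mult_mat_entry:
  assumes "A \<in> carrier_mat p q" "B \<in> carrier_mat q s" "i < p" "j < s"
  shows "(A * B) $$ (i, j) = (\<Sum>k<q. A $$ (i, k) * B $$ (k, j))"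
  using assms by (auto simp: scalar_prod_def atLeast0LessThan)

lemma mult_mat_entry3:
  fixes A B C :: "'a :: comm_semiring_0 mat"
  assumes "A \<in> carrier_mat p q" "B \<in> carrier_mat q s" "C \<in> carrier_mat s t" "i < p" "j < t"
  shows "(A * B * C) $$ (i, j) = (\<Sum>x<q. \<Sum>y<s. A $$ (i, x) * B $$ (x, y) * C $$ (y, j))"
proof -
  have "(A * B * C) $$ (i, j) = (\<Sum>y<s. (\<Sum>x<q. A $$ (i, x) * B $$ (x, y)) * C $$ (y, j))"
    using assms by (simp add: mult_mat_entry [of _ p s _ t] mult_mat_entry [of _ p q _ s]
        del: index_mult_mat assoc_mult_mat)
  also have "\<dots> = (\<Sum>x<q. \<Sum>y<s. A $$ (i, x) * B $$ (x, y) * C $$ (y, j))"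
    by (subst sum.swap) (simp add: sum_distrib_right)
  finally show ?thesis .
qed

text \<open>\<open>mat_inverse\<close> returns \<open>None\<close> only for non-units of the matrix
  ring, and \<open>invertible_mat\<close> supplies a two-sided inverse. That inverse comes without a
  size, which has to be read off from the two product equations first.\<close>

lemma inv_mat_inverse:
  fixes A :: "real mat"
  assumes "A \<in> carrier_mat m m" "invertible_mat A"
  shows "inv_mat A \<in> carrier_mat m m" "inv_mat A * A = 1\<^sub>m m" "A * inv_mat A = 1\<^sub>m m"
proof -
  obtain B where "inverts_mat A B" "inverts_mat B A"
    using assms by (auto simp: invertible_mat_def)
  then have AB: "A * B = 1\<^sub>m m" and "B * A = 1\<^sub>m (dim_row B)"
    using assms by (auto simp: inverts_mat_def)
  then have "B \<in> carrier_mat m m"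
    using assms(1) by (metis carrier_mat_triv carrier_matD(2) index_mult_mat(2,3) index_one_mat(2,3))
  then have "A \<in> Units (ring_mat TYPE(real) m ())"
    using AB assms(1) mat_mult_left_right_inverse [OF assms(1) _ AB]
    by (auto simp: Units_def ring_mat_def)
  then obtain B' where "mat_inverse A = Some B'"
    using mat_inverse(1) [OF assms(1), where b = "()"] by (cases "mat_inverse A") auto
  with mat_inverse(2) [OF assms(1) this]
  show "inv_mat A \<in> carrier_mat m m" "inv_mat A * A = 1\<^sub>m m" "A * inv_mat A = 1\<^sub>m m"
    by (auto simp: inv_mat_def)
qed

text \<open>Multiplying the equation by \<open>W\<^sup>T * T\<close> shows that the columns of
  \<open>U\<close> lie in the range of \<open>A\<close>. Both matrices have \<open>m\<close> columns
  and \<open>U\<close> has a left inverse, so the two ranges agree and the change of basis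
  \<open>G\<close> is invertible.\<close>

lemma full_rank_factor_unique:
  fixes A B U V S :: "real mat"
  assumes A: "A \<in> carrier_mat p m" and B: "B \<in> carrier_mat q m"
    and U: "U \<in> carrier_mat p m" and V: "V \<in> carrier_mat q m"
    and S: "S \<in> carrier_mat m m" and T: "T \<in> carrier_mat m m" "S * T = 1\<^sub>m m"
    and Q: "Q \<in> carrier_mat m p" "Q * U = 1\<^sub>m m"
    and W: "W \<in> carrier_mat m q" "W * V = 1\<^sub>m m"
    and eq: "A * B\<^sup>T = U * S * V\<^sup>T"
  obtains G G' where "G \<in> carrier_mat m m" "G' \<in> carrier_mat m m"
    "G * G' = 1\<^sub>m m" "A = U * G"
proof
  \<comment> \<open>Chosen to solve \<open>A * G' = U\<close>: in the given equation
    \<open>W\<^sup>T\<close> cancels \<open>V\<^sup>T\<close> and \<open>T\<close> cancels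
    \<open>S\<close>.\<close>
  define G' where "G' = B\<^sup>T * (W\<^sup>T * T)"
  show G: "Q * A \<in> carrier_mat m m" and G': "G' \<in> carrier_mat m m"
    using assms by (auto simp: G'_def)
  have VW: "V\<^sup>T * W\<^sup>T = 1\<^sub>m m"
    using transpose_mult [OF W(1) V] W(2) by simp
  have "A * G' = A * B\<^sup>T * (W\<^sup>T * T)"
    unfolding G'_def using A B W(1) T(1) by (simp add: assoc_mult_mat [of A p m _ q _ m])
  also have "\<dots> = U * S * (V\<^sup>T * (W\<^sup>T * T))"
    unfolding eq using U S V W(1) T(1) by (intro assoc_mult_mat [of _ p m _ q _ m]) auto
  also have "V\<^sup>T * (W\<^sup>T * T) = V\<^sup>T * W\<^sup>T * T"
    using V W(1) T(1) by (simp add: assoc_mult_mat [of _ m q _ m _ m])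
  also have "U * S * (V\<^sup>T * W\<^sup>T * T) = U * (S * T)"
    unfolding VW using U S T(1) by simp
  finally have AG': "A * G' = U"
    using U T(2) by simp
  have "Q * A * G' = 1\<^sub>m m"
    using AG' A G' Q by simp
  then show "Q * A * G' = 1\<^sub>m m" .
  \<comment> \<open>One-sided inverses of square matrices are two-sided; this turns
    \<open>A * G' = U\<close> into \<open>A = U * (Q * A)\<close>.\<close>
  from mat_mult_left_right_inverse [OF G G' this] have GG: "G' * (Q * A) = 1\<^sub>m m" .
  have "U * (Q * A) = A * (G' * (Q * A))"
    unfolding AG' [symmetric] using A G' G by simp
  then show "A = U * (Q * A)"
    using GG A by simp
qed

section \<open>Products of core slices\<close>

lemma core_prod_cong:
  "(\<And>j. j \<in> {a<..b} \<Longrightarrow> C j (i j) = C' j (i' j)) \<Longrightarrow>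
   core_prod r C i a b = core_prod r C' i' a b"
  by (induction b) auto

lemma core_prod_empty [simp]: "core_prod r C i a a = 1\<^sub>m (r a)"
  by (cases a) auto

lemma core_prod_Suc:
  "a \<le> b \<Longrightarrow> core_prod r C i a (Suc b) = core_prod r C i a b * C (Suc b) (i (Suc b))"
  by simp

lemma core_prod_carrier:
  assumes "a \<le> b" "\<And>j. j \<in> {a<..b} \<Longrightarrow> C j (i j) \<in> carrier_mat (r (j - 1)) (r j)"
  shows "core_prod r C i a b \<in> carrier_mat (r a) (r b)"
  using assms
proof (induction b rule: dec_induct)
  case (step b)
  have "C (Suc b) (i (Suc b)) \<in> carrier_mat (r b) (r (Suc b))"
    using step.prems [of "Suc b"] step.hyps by simp
  then show ?case
    using step by (simp add: core_prod_Suc del: core_prod.simps)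
qed simp

lemma core_prod_split:
  assumes "a \<le> b" "b \<le> c"
    "\<And>j. j \<in> {a<..c} \<Longrightarrow> C j (i j) \<in> carrier_mat (r (j - 1)) (r j)"
  shows "core_prod r C i a c = core_prod r C i a b * core_prod r C i b c"
  using assms(2,3)
proof (induction c rule: dec_induct)
  case base
  then show ?case
    using core_prod_carrier [of a b C i r] assms(1) by simp
next
  case (step c)
  have "C (Suc c) (i (Suc c)) \<in> carrier_mat (r c) (r (Suc c))"
    using step.prems [of "Suc c"] step.hyps assms(1) by simp
  moreover have "core_prod r C i a b \<in> carrier_mat (r a) (r b)"
    using step assms(1) by (intro core_prod_carrier) auto
  moreover have "core_prod r C i b c \<in> carrier_mat (r b) (r c)"
    using step assms(1) by (intro core_prod_carrier) auto
  ultimately show ?case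
    using step assms(1) by (simp add: core_prod_Suc del: core_prod.simps)
qed

section \<open>Multi-indices, their colexicographic positions, and the frame matrices\<close>

lemma index_setD:
  "i \<in> index_set n d \<Longrightarrow> j \<in> {a<..b} \<Longrightarrow> b \<le> d \<Longrightarrow> i j < n j"
  by (auto simp: index_set_def PiE_iff)

text \<open>True for every position \<open>c\<close>, since \<open>colex_inv\<close> reduces modulo
  \<open>n j\<close> and the membership of \<open>i\<close> makes each such \<open>n j\<close>
  positive.\<close>

lemma override_on_index_set:
  assumes "i \<in> index_set n d" "b \<le> d"
  shows "override_on i (colex_inv n k c) {a<..b} \<in> index_set n d"
proof -
  have "colex_inv n k c j < n j" if "j \<in> {a<..b}" for j
    using index_setD [OF assms(1) that assms(2)] by (simp add: colex_inv_def)
  then show ?thesis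
    using assms by (auto simp: index_set_def PiE_iff override_on_def extensional_def)
qed

text \<open>Moving along a column of the unfolding changes only the first \<open>k\<close> indices.
  In this form a matrix acting from the left becomes a sum over partial replacements of a
  multi-index.\<close>

lemma join_index_left:
  assumes "i \<in> index_set n d" "k \<le> d"
  shows "join_index n d k a (colex n k d i) = override_on i (colex_inv n 0 a) {0<..k}"
proof
  fix j
  have "colex_inv n k (colex n k d i) j = i j" if "j \<in> {k<..d}"
    using assms that by (intro colex_inv_colex) (auto intro: index_setD)
  then show "join_index n d k a (colex n k d i) j = override_on i (colex_inv n 0 a) {0<..k} j"
    using assms by (auto simp: join_index_def override_on_def index_set_def PiE_iff extensional_def)
qed

lemma join_index_right:
  assumes "i \<in> index_set n d" "k \<le> d"
  shows "join_index n d k (colex n 0 k i) a = override_on i (colex_inv n k a) {k<..d}"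
proof
  fix j
  have "colex_inv n 0 (colex n 0 k i) j = i j" if "j \<in> {0<..k}"
    using assms that by (intro colex_inv_colex) (auto intro: index_setD)
  then show "join_index n d k (colex n 0 k i) a j = override_on i (colex_inv n k a) {k<..d} j"
    using assms by (auto simp: join_index_def override_on_def index_set_def PiE_iff extensional_def)
qed

lemma num_indices_pos: "a < num_indices n k l \<Longrightarrow> j \<in> {k<..l} \<Longrightarrow> 0 < n j"
  by (metis finite_greaterThanAtMost gr0I not_less0 num_indices_def prod_zero)

lemma join_index_mem:
  assumes "a < num_indices n 0 k" "b < num_indices n k d" "k \<le> d"
  shows "join_index n d k a b \<in> index_set n d"
  using num_indices_pos [OF assms(1)] num_indices_pos [OF assms(2)] assms(3)
  by (auto simp: join_index_def index_set_def colex_inv_def)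

lemma colex_less_left: "i \<in> index_set n d \<Longrightarrow> k \<le> d \<Longrightarrow> colex n 0 k i < num_indices n 0 k"
  by (intro colex_less) (auto intro: index_setD)

lemma colex_less_right: "i \<in> index_set n d \<Longrightarrow> k \<le> d \<Longrightarrow> colex n k d i < num_indices n k d"
  by (intro colex_less) (auto intro: index_setD)

lemma core_prod_colex_inv:
  assumes "i \<in> index_set n d" "a \<le> b" "b \<le> d"
  shows "core_prod r C (colex_inv n a (colex n a b i)) a b = core_prod r C i a b"
  using colex_inv_colex [OF assms(2), of i n] index_setD [OF assms(1)] assms(3)
  by (intro core_prod_cong) auto

lemma le_mat_colex:
  assumes "i \<in> index_set n d" "k \<le> d" "b < r k"
  shows "le_mat n r U k $$ (colex n 0 k i, b) = core_prod r U i 0 k $$ (0, b)"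
  using assms colex_less_left [OF assms(1,2)] core_prod_colex_inv [OF assms(1), of 0 k r U]
  by (simp add: le_mat_def)

lemma gt_mat_colex:
  assumes "i \<in> index_set n d" "k \<le> d" "b < r k"
  shows "gt_mat n d r V k $$ (colex n k d i, b) = core_prod r V i k d $$ (b, 0)"
  using assms colex_less_right [OF assms(1,2)] core_prod_colex_inv [OF assms(1), of k d r V]
  by (simp add: gt_mat_def)

lemma le_mat_carrier [simp]: "le_mat n r U k \<in> carrier_mat (num_indices n 0 k) (r k)"
  by (simp add: le_mat_def)

lemma gt_mat_carrier [simp]: "gt_mat n d r V k \<in> carrier_mat (num_indices n k d) (r k)"
  by (simp add: gt_mat_def)

lemma unfolding_mat_carrier [simp]:
  "unfolding_mat n d k Z \<in> carrier_mat (num_indices n 0 k) (num_indices n k d)"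
  by (simp add: unfolding_mat_def)

section \<open>Tensors and the summands of the tangent space\<close>

lemma Ten_in_tensor_space [simp]: "Ten n d k M \<in> tensor_space n d"
  by (simp add: Ten_def tensor_space_def)

lemma tensor_eqI:
  "Z \<in> tensor_space n d \<Longrightarrow> Z' \<in> tensor_space n d \<Longrightarrow> (\<And>i. i \<in> index_set n d \<Longrightarrow> Z i = Z' i) \<Longrightarrow>
   Z = Z'"
  unfolding tensor_space_def fun_eq_iff mem_Collect_eq by metis

lemma tensor_space_diff:
  "Z \<in> tensor_space n d \<Longrightarrow> Z' \<in> tensor_space n d \<Longrightarrow> (\<lambda>i. Z i - Z' i) \<in> tensor_space n d"
  by (simp add: tensor_space_def)

text \<open>The cores left and right of mode \<open>j\<close> are separate parameters: with
  \<open>C\<close> on both sides this is a summand of the tangent space, with \<open>U\<close> and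
  \<open>V\<close> it is the same kind of tensor written in the given frames.\<close>

definition tt_summand ::
  "(nat \<Rightarrow> nat) \<Rightarrow> nat \<Rightarrow> (nat \<Rightarrow> nat) \<Rightarrow> (nat \<Rightarrow> core) \<Rightarrow> (nat \<Rightarrow> core) \<Rightarrow> nat \<Rightarrow> core \<Rightarrow> tensor" where
  "tt_summand n d r A B j D =
     (\<lambda>i. if i \<in> index_set n d
          then (core_prod r A i 0 (j - 1) * D (i j) * core_prod r B i j d) $$ (0, 0) else 0)"

lemma tt_summand_in_tensor_space [simp]: "tt_summand n d r A B j D \<in> tensor_space n d"
  by (simp add: tt_summand_def tensor_space_def)

lemma core_slice_carrier:
  "is_core n r j (C j) \<Longrightarrow> i \<in> index_set n d \<Longrightarrow> j \<in> {1..d} \<Longrightarrow>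
   C j (i j) \<in> carrier_mat (r (j - 1)) (r j)"
  by (auto simp: is_core_def index_set_def PiE_iff)

text \<open>Cutting the product before and after mode \<open>j\<close> leaves two outer factors that
  do not see the updated core.\<close>

lemma tt_tensor_update:
  assumes "\<forall>k\<in>{1..d}. is_core n r k (C k)" "is_core n r j D" "j \<in> {1..d}"
  shows "tt_tensor n d r (C(j := D)) = tt_summand n d r C C j D"
proof
  fix i
  define B where "B = C(j := D)"
  have B: "B j = D" "\<And>l. l \<noteq> j \<Longrightarrow> B l = C l"
    by (simp_all add: B_def)
  have "tt_tensor n d r B i = tt_summand n d r C C j D i"
  proof (cases "i \<in> index_set n d")
    case True
    have "is_core n r l (B l)" if "l \<in> {1..d}" for l
      using assms B that by (cases "l = j") auto
    then have c: "B l (i l) \<in> carrier_mat (r (l - 1)) (r l)" if "l \<in> {1..d}" for l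
      using that True by (intro core_slice_carrier) auto
    have "core_prod r B i 0 d = core_prod r B i 0 j * core_prod r B i j d"
      using assms(3) c by (intro core_prod_split) auto
    also have "core_prod r B i 0 j = core_prod r B i 0 (j - 1) * D (i j)"
      using assms(3) core_prod_Suc [of 0 "j - 1" r B i] by (simp add: B)
    also have "core_prod r B i 0 (j - 1) = core_prod r C i 0 (j - 1)"
      by (intro core_prod_cong) (auto simp: B)
    also have "core_prod r B i j d = core_prod r C i j d"
      by (intro core_prod_cong) (auto simp: B)
    finally show ?thesis
      using True by (simp add: tt_tensor_def tt_summand_def)
  qed (simp add: tt_tensor_def tt_summand_def)
  then show "tt_tensor n d r (C(j := D)) i = tt_summand n d r C C j D i"
    by (simp only: B_def)
qed

lemma tt_tangent_space_eq:
  assumes "\<forall>k\<in>{1..d}. is_core n r k (C k)"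
  shows "tt_tangent_space n d r C =
    {Z. \<exists>D. (\<forall>k\<in>{1..d}. is_core n r k (D k)) \<and>
        Z = (\<lambda>i. \<Sum>k = 1..d. tt_summand n d r C C k (D k) i)}"
  using assms by (simp add: tt_tangent_space_def tt_tensor_update cong: conj_cong)

text \<open>
  \<open>L 0\<close> and \<open>R d\<close> belong to the empty groups of indices and make \<open>PL 0\<close> and \<open>PR d\<close> the
  identity, so that the first and the last mode need no separate treatment.
\<close>

locale tt_frames =
  fixes n r :: "nat \<Rightarrow> nat" and d :: nat and U V :: "nat \<Rightarrow> core" and L R :: "nat \<Rightarrow> real mat"
  assumes r0: "r 0 = 1" and rd: "r d = 1"
    and core_U: "k \<in> {1..<d} \<Longrightarrow> is_core n r k (U k)"
    and core_V: "k \<in> {1<..d} \<Longrightarrow> is_core n r k (V k)"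
    and L_carrier: "k < d \<Longrightarrow> L k \<in> carrier_mat (r k) (num_indices n 0 k)"
    and R_carrier: "k \<in> {1..d} \<Longrightarrow> R k \<in> carrier_mat (r k) (num_indices n k d)"
    and L_inverse: "k < d \<Longrightarrow> L k * le_mat n r U k = 1\<^sub>m (r k)"
    and R_inverse: "k \<in> {1..d} \<Longrightarrow> R k * gt_mat n d r V k = 1\<^sub>m (r k)"
begin

section \<open>The projectors in coordinates\<close>

abbreviation "I \<equiv> index_set n d"
abbreviation "E \<equiv> tensor_space n d"

definition PL :: "nat \<Rightarrow> tensor \<Rightarrow> tensor" where
  "PL k Z = Ten n d k (le_mat n r U k * L k * unfolding_mat n d k Z)"

text \<open>\<open>R k\<close> is a left inverse of \<open>gt_mat\<close>, just as
  \<open>L k\<close> is one of \<open>le_mat\<close>; the projector acts on the columns of the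
  unfolding, hence the transpose.\<close>

definition PR :: "nat \<Rightarrow> tensor \<Rightarrow> tensor" where
  "PR k Z = Ten n d k (unfolding_mat n d k Z * (gt_mat n d r V k * R k)\<^sup>T)"

definition u :: "nat \<Rightarrow> multi_index \<Rightarrow> nat \<Rightarrow> real" where
  "u k i b = core_prod r U i 0 k $$ (0, b)"

definition v :: "nat \<Rightarrow> multi_index \<Rightarrow> nat \<Rightarrow> real" where
  "v k i b = core_prod r V i k d $$ (b, 0)"

text \<open>The entry of \<open>L k * unfolding_mat n d k Z\<close> in row \<open>b\<close> and the
  column of \<open>i\<close>, turned into a function of the whole multi-index: the coordinate of
  \<open>Z\<close> along \<open>u k _ b\<close>, with the indices after \<open>k\<close> as
  parameters.\<close>

definition lcoef :: "nat \<Rightarrow> nat \<Rightarrow> tensor \<Rightarrow> tensor" where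
  "lcoef k b Z i = (\<Sum>a<num_indices n 0 k. L k $$ (b, a) * Z (override_on i (colex_inv n 0 a) {0<..k}))"

definition rcoef :: "nat \<Rightarrow> nat \<Rightarrow> tensor \<Rightarrow> tensor" where
  "rcoef k b Z i = (\<Sum>a<num_indices n k d. R k $$ (b, a) * Z (override_on i (colex_inv n k a) {k<..d}))"

lemma PL_in [simp]: "PL k Z \<in> E" and PR_in [simp]: "PR k Z \<in> E"
  by (simp_all add: PL_def PR_def)

text \<open>Replacing the matrix product by an expansion over functions of the full multi-index
  makes projectors that belong to unfoldings of different shapes directly comparable.\<close>

lemma PL_apply:
  assumes i: "i \<in> I" and k: "k < d"
  shows "PL k Z i = (\<Sum>b<r k. u k i b * lcoef k b Z i)"
proof -
  let ?N = "num_indices n 0 k" and ?M = "num_indices n k d"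
  note lt = colex_less_left [OF i, of k] colex_less_right [OF i, of k]
  have c: "L k * unfolding_mat n d k Z \<in> carrier_mat (r k) ?M"
    using L_carrier [OF k] by (intro mult_carrier_mat) auto
  have "PL k Z i = (le_mat n r U k * (L k * unfolding_mat n d k Z)) $$ (colex n 0 k i, colex n k d i)"
    using i L_carrier [OF k]
    by (simp add: PL_def Ten_def assoc_mult_mat [of _ ?N "r k" _ ?N _ ?M])
  also have "\<dots> = (\<Sum>b<r k. le_mat n r U k $$ (colex n 0 k i, b) *
      (L k * unfolding_mat n d k Z) $$ (b, colex n k d i))"
    using lt k c by (intro mult_mat_entry) auto
  also have "\<dots> = (\<Sum>b<r k. u k i b * lcoef k b Z i)"
  proof (intro sum.cong refl arg_cong2 [where f = "(*)"])
    fix b assume b: "b \<in> {..<r k}"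
    then show "le_mat n r U k $$ (colex n 0 k i, b) = u k i b"
      using le_mat_colex [of i n d k b r U] i k by (simp add: u_def)
    have "(L k * unfolding_mat n d k Z) $$ (b, colex n k d i) =
      (\<Sum>a<?N. L k $$ (b, a) * unfolding_mat n d k Z $$ (a, colex n k d i))"
      using lt k b L_carrier [OF k] by (intro mult_mat_entry) auto
    also have "\<dots> = lcoef k b Z i"
      using lt k i by (auto simp: lcoef_def unfolding_mat_def join_index_left intro!: sum.cong)
    finally show "(L k * unfolding_mat n d k Z) $$ (b, colex n k d i) = lcoef k b Z i" .
  qed
  finally show ?thesis .
qed

lemma PR_apply:
  assumes i: "i \<in> I" and k: "k \<in> {1..d}"
  shows "PR k Z i = (\<Sum>b<r k. v k i b * rcoef k b Z i)"
proof -
  let ?N = "num_indices n 0 k" and ?M = "num_indices n k d"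
  have kd: "k \<le> d" using k by simp
  note lt = colex_less_left [OF i kd] colex_less_right [OF i kd]
  have RT: "(R k)\<^sup>T \<in> carrier_mat ?M (r k)"
    using R_carrier [OF k] by simp
  have c: "unfolding_mat n d k Z * (R k)\<^sup>T \<in> carrier_mat ?N (r k)"
    using RT by (intro mult_carrier_mat) auto
  have VT: "(gt_mat n d r V k)\<^sup>T \<in> carrier_mat (r k) ?M" by simp
  have "PR k Z i = (unfolding_mat n d k Z * (R k)\<^sup>T * (gt_mat n d r V k)\<^sup>T) $$ (colex n 0 k i, colex n k d i)"
    using i by (simp add: PR_def Ten_def transpose_mult [of _ ?M "r k" _ ?M] R_carrier [OF k]
        assoc_mult_mat [of _ ?N ?M _ "r k" _ ?M])
  also have "\<dots> = (\<Sum>b<r k. (unfolding_mat n d k Z * (R k)\<^sup>T) $$ (colex n 0 k i, b) *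
      (gt_mat n d r V k)\<^sup>T $$ (b, colex n k d i))"
    using lt c by (intro mult_mat_entry) auto
  also have "\<dots> = (\<Sum>b<r k. rcoef k b Z i * v k i b)"
  proof (intro sum.cong refl arg_cong2 [where f = "(*)"])
    fix b assume b: "b \<in> {..<r k}"
    then show "(gt_mat n d r V k)\<^sup>T $$ (b, colex n k d i) = v k i b"
      using gt_mat_colex [of i n d k b r V] i kd lt by (simp add: v_def gt_mat_def)
    have "(unfolding_mat n d k Z * (R k)\<^sup>T) $$ (colex n 0 k i, b) =
      (\<Sum>a<?M. unfolding_mat n d k Z $$ (colex n 0 k i, a) * (R k)\<^sup>T $$ (a, b))"
      using lt b RT by (intro mult_mat_entry) auto
    also have "\<dots> = rcoef k b Z i"
      using lt kd i b R_carrier [OF k]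
      by (auto simp: rcoef_def unfolding_mat_def join_index_right mult.commute intro!: sum.cong)
    finally show "(unfolding_mat n d k Z * (R k)\<^sup>T) $$ (colex n 0 k i, b) = rcoef k b Z i" .
  qed
  finally show ?thesis by (simp add: mult.commute)
qed

section \<open>Duality of frames and coordinates, and a criterion for fixed tensors\<close>

lemma u_cong: "(\<And>j. j \<in> {0<..k} \<Longrightarrow> i j = i' j) \<Longrightarrow> u k i = u k i'"
  using core_prod_cong [of 0 k U i U i' r] by (simp add: u_def fun_eq_iff)

lemma v_cong: "(\<And>j. j \<in> {k<..d} \<Longrightarrow> i j = i' j) \<Longrightarrow> v k i = v k i'"
  using core_prod_cong [of k d V i V i' r] by (simp add: v_def fun_eq_iff)

lemma L_dual:
  assumes "k < d" "b < r k" "c < r k"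
  shows "(\<Sum>a<num_indices n 0 k. L k $$ (b, a) * u k (colex_inv n 0 a) c) = (if b = c then 1 else 0)"
proof -
  have "(L k * le_mat n r U k) $$ (b, c) = (\<Sum>a<num_indices n 0 k. L k $$ (b, a) * le_mat n r U k $$ (a, c))"
    using assms L_carrier by (intro mult_mat_entry) auto
  then show ?thesis
    using assms L_inverse [OF assms(1)] by (simp add: le_mat_def u_def)
qed

lemma R_dual:
  assumes "k \<in> {1..d}" "b < r k" "c < r k"
  shows "(\<Sum>a<num_indices n k d. R k $$ (b, a) * v k (colex_inv n k a) c) = (if b = c then 1 else 0)"
proof -
  have "(R k * gt_mat n d r V k) $$ (b, c) = (\<Sum>a<num_indices n k d. R k $$ (b, a) * gt_mat n d r V k $$ (a, c))"
    using assms R_carrier by (intro mult_mat_entry) auto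
  then show ?thesis
    using assms R_inverse [OF assms(1)] by (simp add: gt_mat_def v_def)
qed

text \<open>The coefficient functions \<open>W\<close> do not change when the first \<open>k\<close>
  indices are replaced, so the duality \<open>L_dual\<close> recovers them:
  \<open>lcoef k b Z i = W b i\<close>.\<close>

lemma PL_fixes:
  assumes Z: "Z \<in> E" and k: "k < d"
    and form: "\<And>i. i \<in> I \<Longrightarrow> Z i = (\<Sum>b<r k. u k i b * W b i)"
    and W: "\<And>b i i'. i \<in> I \<Longrightarrow> i' \<in> I \<Longrightarrow> (\<And>j. j \<in> {k<..d} \<Longrightarrow> i j = i' j) \<Longrightarrow> W b i = W b i'"
  shows "PL k Z = Z"
proof (rule tensor_eqI)
  fix i assume i: "i \<in> I"
  have "lcoef k b Z i = W b i" if b: "b < r k" for b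
  proof -
    let ?i = "\<lambda>a. override_on i (colex_inv n 0 a) {0<..k}"
    have "u k (?i a) = u k (colex_inv n 0 a)" for a
      by (intro u_cong) simp
    moreover have "W c (?i a) = W c i" for a c
      using i k by (intro W) (auto intro: override_on_index_set)
    ultimately have "Z (?i a) = (\<Sum>c<r k. u k (colex_inv n 0 a) c * W c i)" for a
      using form [OF override_on_index_set [OF i]] k by simp
    then have "lcoef k b Z i =
      (\<Sum>a<num_indices n 0 k. \<Sum>c<r k. L k $$ (b, a) * u k (colex_inv n 0 a) c * W c i)"
      by (simp add: lcoef_def sum_distrib_left mult.assoc)
    also have "\<dots> = (\<Sum>c<r k. (\<Sum>a<num_indices n 0 k. L k $$ (b, a) * u k (colex_inv n 0 a) c) * W c i)"
      by (subst sum.swap) (simp add: sum_distrib_right)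
    also have "\<dots> = (\<Sum>c<r k. if b = c then W c i else 0)"
      using L_dual [OF k b] by (intro sum.cong) auto
    finally show ?thesis
      using b by simp
  qed
  then show "PL k Z i = Z i"
    using form [OF i] PL_apply [OF i k] by simp
qed (use Z in auto)

lemma PR_fixes:
  assumes Z: "Z \<in> E" and k: "k \<in> {1..d}"
    and form: "\<And>i. i \<in> I \<Longrightarrow> Z i = (\<Sum>b<r k. v k i b * W b i)"
    and W: "\<And>b i i'. i \<in> I \<Longrightarrow> i' \<in> I \<Longrightarrow> (\<And>j. j \<in> {0<..k} \<Longrightarrow> i j = i' j) \<Longrightarrow> W b i = W b i'"
  shows "PR k Z = Z"
proof (rule tensor_eqI)
  fix i assume i: "i \<in> I"
  have "rcoef k b Z i = W b i" if b: "b < r k" for b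
  proof -
    let ?i = "\<lambda>a. override_on i (colex_inv n k a) {k<..d}"
    have "v k (?i a) = v k (colex_inv n k a)" for a
      by (intro v_cong) simp
    moreover have "W c (?i a) = W c i" for a c
      using i k by (intro W) (auto intro: override_on_index_set)
    ultimately have "Z (?i a) = (\<Sum>c<r k. v k (colex_inv n k a) c * W c i)" for a
      using form [OF override_on_index_set [OF i]] k by simp
    then have "rcoef k b Z i =
      (\<Sum>a<num_indices n k d. \<Sum>c<r k. R k $$ (b, a) * v k (colex_inv n k a) c * W c i)"
      by (simp add: rcoef_def sum_distrib_left mult.assoc)
    also have "\<dots> = (\<Sum>c<r k. (\<Sum>a<num_indices n k d. R k $$ (b, a) * v k (colex_inv n k a) c) * W c i)"
      by (subst sum.swap) (simp add: sum_distrib_right)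
    also have "\<dots> = (\<Sum>c<r k. if b = c then W c i else 0)"
      using R_dual [OF k b] by (intro sum.cong) auto
    finally show ?thesis
      using b by simp
  qed
  then show "PR k Z i = Z i"
    using form [OF i] PR_apply [OF i k] by simp
qed (use Z in auto)

section \<open>Dependence on groups of indices, nestedness and commutation\<close>

lemma agree_on_index_set:
  assumes "i \<in> I" "i' \<in> I" "\<And>j. j \<in> {1..d} \<Longrightarrow> i j = i' j"
  shows "i = i'"
  using assms unfolding index_set_def by (intro PiE_ext)

text \<open>\<open>i\<close> and \<open>i'\<close> become the same multi-index once their first
  \<open>k\<close> components are overwritten.\<close>

lemma lcoef_cong:
  assumes "i \<in> I" "i' \<in> I" "\<And>j. j \<in> {k<..d} \<Longrightarrow> i j = i' j" "k \<le> d"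
  shows "lcoef k b Z i = lcoef k b Z i'"
proof -
  have "override_on i (colex_inv n 0 a) {0<..k} = override_on i' (colex_inv n 0 a) {0<..k}" for a
    using assms by (intro agree_on_index_set override_on_index_set) (auto simp: override_on_def)
  then show ?thesis by (simp add: lcoef_def)
qed

lemma rcoef_cong:
  assumes "i \<in> I" "i' \<in> I" "\<And>j. j \<in> {0<..k} \<Longrightarrow> i j = i' j" "k \<le> d"
  shows "rcoef k b Z i = rcoef k b Z i'"
proof -
  have "override_on i (colex_inv n k a) {k<..d} = override_on i' (colex_inv n k a) {k<..d}" for a
    using assms by (intro agree_on_index_set override_on_index_set) (auto simp: override_on_def)
  then show ?thesis by (simp add: rcoef_def)
qed

lemma U_slice: "i \<in> I \<Longrightarrow> j \<in> {1..<d} \<Longrightarrow> U j (i j) \<in> carrier_mat (r (j - 1)) (r j)"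
  using core_U by (intro core_slice_carrier) auto

lemma V_slice: "i \<in> I \<Longrightarrow> j \<in> {1<..d} \<Longrightarrow> V j (i j) \<in> carrier_mat (r (j - 1)) (r j)"
  using core_V by (intro core_slice_carrier) auto

lemma U_prod: "i \<in> I \<Longrightarrow> j \<le> k \<Longrightarrow> k < d \<Longrightarrow> core_prod r U i j k \<in> carrier_mat (r j) (r k)"
  by (intro core_prod_carrier) (auto intro: U_slice [simplified])

lemma V_prod: "i \<in> I \<Longrightarrow> 1 \<le> j \<Longrightarrow> j \<le> k \<Longrightarrow> k \<le> d \<Longrightarrow> core_prod r V i j k \<in> carrier_mat (r j) (r k)"
  by (intro core_prod_carrier) (auto intro: V_slice [simplified])

text \<open>Nestedness of the left frames: for fixed indices after \<open>j\<close>, every column of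
  the frame at \<open>k\<close> is a combination of columns of the frame at
  \<open>j\<close>.\<close>

lemma u_split:
  assumes "i \<in> I" "j \<le> k" "k < d" "c < r k"
  shows "u k i c = (\<Sum>b<r j. u j i b * core_prod r U i j k $$ (b, c))"
proof -
  have "core_prod r U i 0 k = core_prod r U i 0 j * core_prod r U i j k"
    using assms by (intro core_prod_split) (auto intro: U_slice [simplified])
  then show ?thesis
    unfolding u_def using assms U_prod [of i 0 j] U_prod [of i j k] r0
    by (simp add: mult_mat_entry [of _ 1 "r j" _ "r k"] del: index_mult_mat)
qed

lemma v_split:
  assumes "i \<in> I" "1 \<le> j" "j \<le> k" "k \<le> d" "c < r j"
  shows "v j i c = (\<Sum>b<r k. v k i b * core_prod r V i j k $$ (c, b))"
proof -
  have "core_prod r V i j d = core_prod r V i j k * core_prod r V i k d"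
    using assms by (intro core_prod_split) (auto intro: V_slice [simplified])
  then show ?thesis
    unfolding v_def using assms V_prod [of i j k] V_prod [of i k d] rd
    by (simp add: mult_mat_entry [of _ "r j" "r k" _ 1] mult.commute del: index_mult_mat)
qed

text \<open>By \<open>u_split\<close> the tensor \<open>PL k Z\<close> is an expansion over
  \<open>u j\<close> whose coefficients involve only indices after \<open>j\<close>, as
  \<open>PL_fixes\<close> demands. The case \<open>j = k\<close> is idempotence.\<close>

lemma PL_PL:
  assumes "j \<le> k" "k < d"
  shows "PL j (PL k Z) = PL k Z"
proof (rule PL_fixes)
  fix i assume i: "i \<in> I"
  have "PL k Z i = (\<Sum>c<r k. \<Sum>b<r j. u j i b * core_prod r U i j k $$ (b, c) * lcoef k c Z i)"
    using PL_apply [OF i, of k] u_split [OF i] assms by (simp add: sum_distrib_right)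
  also have "\<dots> = (\<Sum>b<r j. u j i b * (\<Sum>c<r k. core_prod r U i j k $$ (b, c) * lcoef k c Z i))"
    by (subst sum.swap) (simp add: sum_distrib_left mult.assoc)
  finally show "PL k Z i = \<dots>" .
next
  fix b i i' assume i: "i \<in> I" "i' \<in> I" and eq: "\<And>l. l \<in> {j<..d} \<Longrightarrow> i l = i' l"
  have "core_prod r U i j k = core_prod r U i' j k"
    using eq assms by (intro core_prod_cong) auto
  moreover have "lcoef k c Z i = lcoef k c Z i'" for c
    using i eq assms by (intro lcoef_cong) auto
  ultimately show "(\<Sum>c<r k. core_prod r U i j k $$ (b, c) * lcoef k c Z i) =
      (\<Sum>c<r k. core_prod r U i' j k $$ (b, c) * lcoef k c Z i')"
    by simp
qed (use assms in auto)

text \<open>The mirror image of \<open>PL_PL\<close>. Here the range grows with the index, so the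
  larger index belongs to the outer operator.\<close>

lemma PR_PR:
  assumes "1 \<le> j" "j \<le> k" "k \<le> d"
  shows "PR k (PR j Z) = PR j Z"
proof (rule PR_fixes)
  fix i assume i: "i \<in> I"
  have "PR j Z i = (\<Sum>c<r j. \<Sum>b<r k. v k i b * core_prod r V i j k $$ (c, b) * rcoef j c Z i)"
    using PR_apply [OF i, of j] v_split [OF i] assms by (simp add: sum_distrib_right)
  also have "\<dots> = (\<Sum>b<r k. v k i b * (\<Sum>c<r j. core_prod r V i j k $$ (c, b) * rcoef j c Z i))"
    by (subst sum.swap) (simp add: sum_distrib_left mult.assoc)
  finally show "PR j Z i = \<dots>" .
next
  fix b i i' assume i: "i \<in> I" "i' \<in> I" and eq: "\<And>l. l \<in> {0<..k} \<Longrightarrow> i l = i' l"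
  have "core_prod r V i j k = core_prod r V i' j k"
    using eq assms by (intro core_prod_cong) auto
  moreover have "rcoef j c Z i = rcoef j c Z i'" for c
    using i eq assms by (intro rcoef_cong) auto
  ultimately show "(\<Sum>c<r j. core_prod r V i j k $$ (c, b) * rcoef j c Z i) =
      (\<Sum>c<r j. core_prod r V i' j k $$ (c, b) * rcoef j c Z i')"
    by simp
qed (use assms in auto)

lemma override_on_commute:
  "j \<le> k \<Longrightarrow> override_on (override_on i f {0<..j}) g {k<..d} = override_on (override_on i g {k<..d}) f {0<..j}"
  by (auto simp: override_on_def)

lemma PL_PR_commute:
  assumes "j \<le> k" "j < d" "1 \<le> k" "k \<le> d"
  shows "PL j (PR k Z) = PR k (PL j Z)"
proof (rule tensor_eqI)
  fix i assume i: "i \<in> I"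
  let ?l = "\<lambda>a i. override_on i (colex_inv n 0 a) {0<..j}"
  let ?r = "\<lambda>a i. override_on i (colex_inv n k a) {k<..d}"
  let ?N = "num_indices n 0 j" and ?M = "num_indices n k d"
  have comm: "?r e (?l a i) = ?l a (?r e i)" for a e
    using assms(1) by (rule override_on_commute)
  have mem: "?l a i \<in> I" "?r e i \<in> I" for a e
    using i assms by (auto intro: override_on_index_set)
  \<comment> \<open>\<open>v k\<close> reads only indices after \<open>k\<close> and
    \<open>u j\<close> only those up to \<open>j\<close>, so neither notices the replacement made by
    the other operator.\<close>
  have inv: "v k (?l a i) = v k i" "u j (?r e i) = u j i" for a e
    using assms by (auto intro!: v_cong u_cong simp: override_on_def)
  \<comment> \<open>Both compositions expand to the same fourfold sum; what follows only
    interchanges the order of summation.\<close>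
  have "PL j (PR k Z) i = (\<Sum>b<r j. \<Sum>a<?N. \<Sum>c<r k. \<Sum>e<?M.
      u j i b * (L j $$ (b, a) * (v k i c * (R k $$ (c, e) * Z (?r e (?l a i))))))"
    using assms i by (simp add: PL_apply lcoef_def PR_apply rcoef_def mem inv sum_distrib_left)
  also have "\<dots> = (\<Sum>b<r j. \<Sum>c<r k. \<Sum>e<?M. \<Sum>a<?N.
      u j i b * (L j $$ (b, a) * (v k i c * (R k $$ (c, e) * Z (?r e (?l a i))))))"
    by (rule sum.cong [OF refl], subst sum.swap, rule sum.cong [OF refl], rule sum.swap)
  also have "\<dots> = (\<Sum>c<r k. \<Sum>e<?M. \<Sum>b<r j. \<Sum>a<?N.
      u j i b * (L j $$ (b, a) * (v k i c * (R k $$ (c, e) * Z (?r e (?l a i))))))"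
    by (subst sum.swap, rule sum.cong [OF refl], rule sum.swap)
  also have "\<dots> = (\<Sum>c<r k. \<Sum>e<?M. \<Sum>b<r j. \<Sum>a<?N.
      v k i c * (R k $$ (c, e) * (u j i b * (L j $$ (b, a) * Z (?l a (?r e i))))))"
    by (intro sum.cong refl) (simp add: comm mult.left_commute)
  also have "\<dots> = PR k (PL j Z) i"
    using assms i by (simp add: PL_apply lcoef_def PR_apply rcoef_def mem inv sum_distrib_left)
  finally show "PL j (PR k Z) i = PR k (PL j Z) i" .
qed auto

text \<open>Since \<open>r 0 = 1\<close> and the empty product is the identity, the expansion over
  \<open>u 0\<close> has one term with factor 1, and \<open>Z\<close> itself serves as its
  coefficient.\<close>

lemma PL_zero:
  assumes "Z \<in> E" "0 < d"
  shows "PL 0 Z = Z"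
proof (rule PL_fixes [where W = "\<lambda>b. Z"])
  fix i i' assume "i \<in> I" "i' \<in> I" "\<And>j. j \<in> {0<..d} \<Longrightarrow> i j = i' j"
  then have "i = i'"
    by (intro agree_on_index_set) auto
  then show "Z i = Z i'" by (rule arg_cong)
next
  fix i
  show "Z i = (\<Sum>b<r 0. u 0 i b * Z i)"
    unfolding u_def core_prod_empty r0 by simp
qed (use assms in auto)

lemma PR_d:
  assumes "Z \<in> E" "0 < d"
  shows "PR d Z = Z"
proof (rule PR_fixes [where W = "\<lambda>b. Z"])
  fix i i' assume "i \<in> I" "i' \<in> I" "\<And>j. j \<in> {0<..d} \<Longrightarrow> i j = i' j"
  then have "i = i'"
    by (intro agree_on_index_set) auto
  then show "Z i = Z i'" by (rule arg_cong)
next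
  fix i
  show "Z i = (\<Sum>b<r d. v d i b * Z i)"
    unfolding v_def core_prod_empty rd by simp
qed (use assms in auto)

section \<open>Linearity of the projectors\<close>

lemma PL_outside: "i \<notin> I \<Longrightarrow> PL k Z i = 0" and PR_outside: "i \<notin> I \<Longrightarrow> PR k Z i = 0"
  by (simp_all add: PL_def PR_def Ten_def)

lemma PL_linear:
  assumes "k < d"
  shows "PL k (\<lambda>i. a * Z i + b * Z' i) = (\<lambda>i. a * PL k Z i + b * PL k Z' i)"
proof
  fix i
  have "lcoef k c (\<lambda>i. a * Z i + b * Z' i) i = a * lcoef k c Z i + b * lcoef k c Z' i" for c
    by (simp add: lcoef_def algebra_simps sum.distrib sum_distrib_left)
  then show "PL k (\<lambda>i. a * Z i + b * Z' i) i = a * PL k Z i + b * PL k Z' i"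
    by (cases "i \<in> I")
      (simp_all add: PL_apply assms PL_outside algebra_simps sum.distrib sum_distrib_left)
qed

lemma PR_linear:
  assumes "k \<in> {1..d}"
  shows "PR k (\<lambda>i. a * Z i + b * Z' i) = (\<lambda>i. a * PR k Z i + b * PR k Z' i)"
proof
  fix i
  have "rcoef k c (\<lambda>i. a * Z i + b * Z' i) i = a * rcoef k c Z i + b * rcoef k c Z' i" for c
    by (simp add: rcoef_def algebra_simps sum.distrib sum_distrib_left)
  then show "PR k (\<lambda>i. a * Z i + b * Z' i) i = a * PR k Z i + b * PR k Z' i"
    using assms by (cases "i \<in> I")
      (simp_all add: PR_apply PR_outside algebra_simps sum.distrib sum_distrib_left)
qed

section \<open>The summands of the tangent space as common fixed spaces of \<open>PL\<close> and
  \<open>PR\<close>\<close>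

definition T :: "nat \<Rightarrow> tensor set" where
  "T j = {Z \<in> E. PL (j - 1) Z = Z \<and> PR j Z = Z}"

lemma T_diff:
  assumes "j \<in> {1..d}" "Z \<in> T j" "Z' \<in> T j"
  shows "(\<lambda>i. Z i - Z' i) \<in> T j"
  using assms PL_linear [of "j - 1" 1 Z "-1" Z'] PR_linear [of j 1 Z "-1" Z']
  by (auto simp: T_def intro: tensor_space_diff)

lemma tt_summand_apply:
  assumes "i \<in> I" "j \<in> {1..d}" "is_core n r j D"
  shows "tt_summand n d r U V j D i =
    (\<Sum>b<r (j - 1). \<Sum>c<r j. u (j - 1) i b * D (i j) $$ (b, c) * v j i c)"
proof -
  have "core_prod r U i 0 (j - 1) \<in> carrier_mat 1 (r (j - 1))"
    "core_prod r V i j d \<in> carrier_mat (r j) 1" "D (i j) \<in> carrier_mat (r (j - 1)) (r j)"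
    using assms U_prod [of i 0 "j - 1"] V_prod [of i j d] r0 rd core_slice_carrier [of n r j "\<lambda>_. D" i d]
    by auto
  then show ?thesis
    using mult_mat_entry3 [of "core_prod r U i 0 (j - 1)" 1 "r (j - 1)" "D (i j)" "r j" "core_prod r V i j d" 1 0 0]
      assms(1) unfolding tt_summand_def u_def v_def by simp
qed

text \<open>The double sum over \<open>b\<close> and \<open>c\<close> is grouped in two ways: by
  \<open>b\<close> it is an expansion over \<open>u (j - 1)\<close>, by \<open>c\<close> one over
  \<open>v j\<close>. The core \<open>D\<close> depends on the index \<open>j\<close> alone, which
  both groupings allow in their coefficients.\<close>

lemma tt_summand_in_T:
  assumes j: "j \<in> {1..d}" and D: "is_core n r j D"
  shows "tt_summand n d r U V j D \<in> T j"
proof -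
  let ?Z = "tt_summand n d r U V j D"
  have "PL (j - 1) ?Z = ?Z"
  proof (rule PL_fixes [where W = "\<lambda>b i. \<Sum>c<r j. D (i j) $$ (b, c) * v j i c"])
    fix b i i' assume "i \<in> I" "i' \<in> I" and eq: "\<And>l. l \<in> {j - 1<..d} \<Longrightarrow> i l = i' l"
    have "v j i = v j i'"
      using eq j by (intro v_cong) auto
    moreover have "i j = i' j"
      using eq j by auto
    ultimately show "(\<Sum>c<r j. D (i j) $$ (b, c) * v j i c) = (\<Sum>c<r j. D (i' j) $$ (b, c) * v j i' c)"
      by simp
  qed (use j in \<open>auto simp: tt_summand_apply [OF _ j D] sum_distrib_left mult.assoc\<close>)
  moreover have "PR j ?Z = ?Z"
  proof (rule PR_fixes [where W = "\<lambda>c i. \<Sum>b<r (j - 1). u (j - 1) i b * D (i j) $$ (b, c)"])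
    fix i assume "i \<in> I"
    then show "?Z i = (\<Sum>c<r j. v j i c * (\<Sum>b<r (j - 1). u (j - 1) i b * D (i j) $$ (b, c)))"
      by (simp add: tt_summand_apply [OF _ j D], subst sum.swap) (simp add: sum_distrib_left mult.commute)
  next
    fix b i i' assume "i \<in> I" "i' \<in> I" and eq: "\<And>l. l \<in> {0<..j} \<Longrightarrow> i l = i' l"
    have "u (j - 1) i = u (j - 1) i'"
      using eq j by (intro u_cong) auto
    moreover have "i j = i' j"
      using eq j by auto
    ultimately show "(\<Sum>c<r (j - 1). u (j - 1) i c * D (i j) $$ (c, b)) = (\<Sum>c<r (j - 1). u (j - 1) i' c * D (i' j) $$ (c, b))"
      by simp
  qed (use j in auto)
  ultimately show ?thesis
    by (simp add: T_def)
qed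

text \<open>Contracting \<open>Z\<close> with the dual functionals on both sides of mode
  \<open>j\<close> leaves a family of matrices indexed by that mode, and these are the slices of the
  core.\<close>

lemma T_imp_tt_summand:
  assumes j: "j \<in> {1..d}" and Z: "Z \<in> T j"
  obtains D where "is_core n r j D" "Z = tt_summand n d r U V j D"
proof
  \<comment> \<open>The multi-index with component \<open>m\<close> at mode \<open>j\<close> whose
    left and right groups are decoded from the positions \<open>a\<close> and
    \<open>e\<close>.\<close>
  define idx where "idx a e m =
    (\<lambda>l\<in>{1..d}. if l < j then colex_inv n 0 a l else if l = j then m else colex_inv n j e l)" for a e m
  let ?N = "num_indices n 0 (j - 1)" and ?M = "num_indices n j d"
  define D where "D m = mat (r (j - 1)) (r j)
    (\<lambda>(b, c). \<Sum>a<?N. \<Sum>e<?M. L (j - 1) $$ (b, a) * (R j $$ (c, e) * Z (idx a e m)))" for m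
  show D: "is_core n r j D"
    by (simp add: is_core_def D_def)
  show "Z = tt_summand n d r U V j D"
  proof (rule tensor_eqI)
    fix i assume i: "i \<in> I"
    let ?l = "\<lambda>a. override_on i (colex_inv n 0 a) {0<..j - 1}"
    have j': "j - 1 < d"
      using j by auto
    have mem: "?l a \<in> I" for a
      using i j by (intro override_on_index_set) auto
    have v: "v j (?l a) = v j i" for a
      using j by (intro v_cong) (auto simp: override_on_def)
    have idx: "override_on (?l a) (colex_inv n j e) {j<..d} = idx a e (i j)" for a e
      using i j by (intro ext) (auto simp: override_on_def idx_def index_set_def PiE_iff extensional_def)
    \<comment> \<open>Both operators fix \<open>Z\<close>; expanding them produces the entries of
      \<open>D\<close>.\<close>
    have "Z i = PL (j - 1) (PR j Z) i"
      using Z by (simp add: T_def)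
    also have "\<dots> = (\<Sum>b<r (j - 1). \<Sum>a<?N. \<Sum>c<r j. \<Sum>e<?M. u (j - 1) i b *
        (L (j - 1) $$ (b, a) * (v j i c * (R j $$ (c, e) * Z (idx a e (i j))))))"
      using j i j' by (simp add: PL_apply lcoef_def PR_apply rcoef_def mem v idx sum_distrib_left del: One_nat_def)
    also have "\<dots> = (\<Sum>b<r (j - 1). \<Sum>c<r j. \<Sum>a<?N. \<Sum>e<?M. u (j - 1) i b *
        (L (j - 1) $$ (b, a) * (v j i c * (R j $$ (c, e) * Z (idx a e (i j))))))"
      by (rule sum.cong [OF refl], rule sum.swap)
    also have "\<dots> = (\<Sum>b<r (j - 1). \<Sum>c<r j. u (j - 1) i b * D (i j) $$ (b, c) * v j i c)"
      by (intro sum.cong refl) (simp add: D_def sum_distrib_left sum_distrib_right mult_ac)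
    finally show "Z i = tt_summand n d r U V j D i"
      using tt_summand_apply [OF i j D] by simp
  qed (use Z in \<open>auto simp: T_def\<close>)
qed

section \<open>The tangent space projector for general left inverses\<close>

definition P :: "tensor \<Rightarrow> tensor" where
  "P Z = (\<lambda>i. (\<Sum>k = 1..d-1. PL (k - 1) (PR k Z) i - PL k (PR k Z) i) + PL (d - 1) Z i)"

definition TS :: "tensor set" where
  "TS = {Z. \<exists>X. (\<forall>k\<in>{1..d}. X k \<in> T k) \<and> Z = (\<lambda>i. \<Sum>k = 1..d. X k i)}"

lemma P_linear:
  assumes "0 < d"
  shows "P (\<lambda>i. a * Z i + b * Z' i) = (\<lambda>i. a * P Z i + b * P Z' i)"
proof
  fix i
  have "(\<Sum>k = 1..d-1. PL (k - 1) (PR k (\<lambda>i. a * Z i + b * Z' i)) i - PL k (PR k (\<lambda>i. a * Z i + b * Z' i)) i)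
    = (\<Sum>k = 1..d-1. a * (PL (k - 1) (PR k Z) i - PL k (PR k Z) i) + b * (PL (k - 1) (PR k Z') i - PL k (PR k Z') i))"
    by (intro sum.cong refl) (auto simp: PL_linear PR_linear algebra_simps)
  also have "\<dots> = a * (\<Sum>k = 1..d-1. PL (k - 1) (PR k Z) i - PL k (PR k Z) i)
    + b * (\<Sum>k = 1..d-1. PL (k - 1) (PR k Z') i - PL k (PR k Z') i)"
    by (simp only: sum.distrib sum_distrib_left)
  finally show "P (\<lambda>i. a * Z i + b * Z' i) i = a * P Z i + b * P Z' i"
    using assms by (simp add: P_def PL_linear algebra_simps)
qed

lemma P_zero: "0 < d \<Longrightarrow> P (\<lambda>i. 0) = (\<lambda>i. 0)"
  using P_linear [of 0 "\<lambda>i. 0" 0 "\<lambda>i. 0"] by simp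

lemma P_sum:
  assumes "0 < d" "finite A"
  shows "P (\<lambda>i. \<Sum>x\<in>A. X x i) = (\<lambda>i. \<Sum>x\<in>A. P (X x) i)"
  using assms(2)
proof induction
  case empty
  then show ?case using P_zero assms by simp
next
  case (insert x A)
  then show ?case
    using P_linear [OF assms(1), of 1 "X x" 1 "\<lambda>i. \<Sum>x\<in>A. X x i"] by simp
qed

lemma P_fixes_T:
  assumes j: "j \<in> {1..d}" and Z: "Z \<in> T j"
  shows "P Z = Z"
proof
  fix i
  have PL_Z: "PL k Z = Z" if "k < j" for k
    using PL_PL [of k "j - 1" Z] Z j that by (simp add: T_def)
  have PR_Z: "PR k Z = Z" if "j \<le> k" "k \<le> d" for k
    using PR_PR [of j k Z] Z j that by (simp add: T_def)
  let ?t = "\<lambda>k. PL (k - 1) (PR k Z) i - PL k (PR k Z) i"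
  have "(\<Sum>k = 1..d-1. ?t k) = (\<Sum>k = j..d-1. ?t k)"
  proof (rule sum.mono_neutral_right)
    \<comment> \<open>For \<open>k < j\<close> both \<open>PL (k - 1)\<close> and
      \<open>PL k\<close> fix \<open>Z\<close>, so after commuting with \<open>PR k\<close> both
      terms of the difference equal \<open>PR k Z i\<close>.\<close>
    show "\<forall>k\<in>{1..d-1} - {j..d-1}. ?t k = 0"
      using PL_Z j by (auto simp: PL_PR_commute)
  qed (use j in auto)
  also have "\<dots> = (\<Sum>k = j..d-1. PL (k - 1) Z i - PL k Z i)"
    by (intro sum.cong refl) (auto simp: PR_Z)
  \<comment> \<open>Telescoping of the negated sequence; for \<open>j = d\<close> the sum is empty
    and both sides vanish. The last term of \<open>P\<close> then cancels
    \<open>PL (d - 1) Z i\<close>.\<close>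
  also have "\<dots> = PL (j - 1) Z i - PL (d - 1) Z i"
    using sum_telescope'' [of "j - 1" "d - 1" "\<lambda>k. - PL k Z i"] j diff_le_mono [of j d 1]
    by (simp add: atLeastSucAtMost_greaterThanAtMost [symmetric])
  finally show "P Z i = Z i"
    using PL_Z [of "j - 1"] j by (simp add: P_def)
qed

lemma P_in_TS:
  assumes "0 < d" "Z \<in> E"
  shows "P Z \<in> TS"
proof -
  \<comment> \<open>The last term of \<open>P\<close> takes the slot \<open>d\<close>, where
    \<open>PR d\<close> is the identity; the slots below hold the differences.\<close>
  define X where "X k = (if k = d then PL (d - 1) Z else (\<lambda>i. PL (k - 1) (PR k Z) i - PL k (PR k Z) i))" for k
  have "X k \<in> T k" if k: "k \<in> {1..d}" for k
  proof (cases "k = d")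
    case True
    then show ?thesis
      using assms by (simp add: X_def T_def PL_PL PR_d)
  next
    case False
    \<comment> \<open>\<open>PL (k - 1)\<close> fixes the range of \<open>PL k\<close> by nestedness
      and \<open>PR k\<close> passes through \<open>PL l\<close>, so both terms of the difference
      lie in \<open>T k\<close> separately.\<close>
    have "PL l (PR k Z) \<in> T k" if "l \<in> {k - 1, k}" for l
      using that k False by (auto simp: T_def PL_PL PR_PR PL_PR_commute [symmetric])
    then show ?thesis
      using False k by (auto simp: X_def intro: T_diff)
  qed
  moreover have "P Z i = (\<Sum>k = 1..d. X k i)" for i
  proof -
    have "{1..d} = insert d {1..d-1}"
      using assms by auto
    then have "(\<Sum>k = 1..d. X k i) = X d i + (\<Sum>k = 1..d-1. X k i)"
      using assms by simp
    also have "(\<Sum>k = 1..d-1. X k i) = (\<Sum>k = 1..d-1. PL (k - 1) (PR k Z) i - PL k (PR k Z) i)"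
      by (intro sum.cong) (auto simp: X_def)
    finally show ?thesis
      by (simp add: P_def X_def)
  qed
  ultimately show ?thesis
    unfolding TS_def by (intro CollectI exI [of _ X]) auto
qed

lemma P_fixes_TS: "0 < d \<Longrightarrow> Z \<in> TS \<Longrightarrow> P Z = Z"
  by (auto simp: TS_def P_sum P_fixes_T intro!: sum.cong ext)

lemma TS_subset: "TS \<subseteq> E"
  by (auto simp: TS_def T_def tensor_space_def intro!: sum.neutral)

text \<open>A linear map into \<open>TS\<close> that fixes \<open>TS\<close> pointwise is idempotent
  with image \<open>TS\<close>.\<close>

lemma P_projector:
  assumes "0 < d"
  shows "oblique_projector_onto E P TS"
  unfolding oblique_projector_onto_def
  using P_in_TS [OF assms] P_fixes_TS [OF assms] TS_subset P_linear [OF assms]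
  by (auto simp: image_iff) (metis subsetD)

end

section \<open>Change of gauge between two sets of cores\<close>

lemma unfolding_factorization_entry:
  assumes a: "a < num_indices n 0 k" and b: "b < num_indices n k d" and k: "k \<le> d"
    and i: "i = join_index n d k a b" and M: "M \<in> carrier_mat (r k) (r k)"
    and A: "core_prod r A i 0 k \<in> carrier_mat 1 (r k)"
    and B: "core_prod r B i k d \<in> carrier_mat (r k) 1"
  shows "(le_mat n r A k * M * (gt_mat n d r B k)\<^sup>T) $$ (a, b) =
    (core_prod r A i 0 k * M * core_prod r B i k d) $$ (0, 0)"
proof -
  have l: "le_mat n r A k $$ (a, x) = core_prod r A i 0 k $$ (0, x)" if "x < r k" for x
    using a k that core_prod_cong [of 0 k A "colex_inv n 0 a" A i r]
    by (simp add: le_mat_def i join_index_def)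
  have g: "(gt_mat n d r B k)\<^sup>T $$ (x, b) = core_prod r B i k d $$ (x, 0)" if "x < r k" for x
    using b k that core_prod_cong [of k d B "colex_inv n k b" B i r]
    by (simp add: gt_mat_def i join_index_def)
  have "(le_mat n r A k * M * (gt_mat n d r B k)\<^sup>T) $$ (a, b) =
    (\<Sum>x<r k. \<Sum>y<r k. le_mat n r A k $$ (a, x) * M $$ (x, y) * (gt_mat n d r B k)\<^sup>T $$ (y, b))"
    using a b M by (intro mult_mat_entry3) auto
  also have "\<dots> = (\<Sum>x<r k. \<Sum>y<r k. core_prod r A i 0 k $$ (0, x) * M $$ (x, y) * core_prod r B i k d $$ (y, 0))"
    by (intro sum.cong refl) (simp add: l g)
  also have "\<dots> = (core_prod r A i 0 k * M * core_prod r B i k d) $$ (0, 0)"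
    by (rule mult_mat_entry3 [OF A M B, symmetric]) auto
  finally show ?thesis .
qed

text \<open>The product of the first \<open>k\<close> slices is the row of the frame at position
  \<open>colex n 0 k i\<close>, so a relation between frames passes to every product.\<close>

lemma core_prod_of_le_mat:
  assumes eq: "le_mat n r A k = le_mat n r B k * G" and G: "G \<in> carrier_mat (r k) (r k)"
    and i: "i \<in> index_set n d" and k: "k \<le> d"
    and A: "core_prod r A i 0 k \<in> carrier_mat 1 (r k)"
    and B: "core_prod r B i 0 k \<in> carrier_mat 1 (r k)"
  shows "core_prod r A i 0 k = core_prod r B i 0 k * G"
proof (rule eq_matI)
  fix x y assume xy: "x < dim_row (core_prod r B i 0 k * G)" "y < dim_col (core_prod r B i 0 k * G)"
  then have [simp]: "x = 0" and y: "y < r k"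
    using B G by auto
  have "core_prod r A i 0 k $$ (0, y) = (le_mat n r B k * G) $$ (colex n 0 k i, y)"
    using le_mat_colex [of i n d k y r A] i k y eq by simp
  also have "\<dots> = (\<Sum>z<r k. le_mat n r B k $$ (colex n 0 k i, z) * G $$ (z, y))"
    using colex_less_left [OF i k] G y by (intro mult_mat_entry) auto
  also have "\<dots> = (\<Sum>z<r k. core_prod r B i 0 k $$ (0, z) * G $$ (z, y))"
    by (intro sum.cong refl) (simp add: le_mat_colex [OF i k])
  also have "\<dots> = (core_prod r B i 0 k * G) $$ (0, y)"
    using B G y by (intro mult_mat_entry [symmetric]) auto
  finally show "core_prod r A i 0 k $$ (x, y) = (core_prod r B i 0 k * G) $$ (x, y)"
    by simp
qed (use A B G in auto)

lemma core_prod_of_gt_mat: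
  assumes eq: "gt_mat n d r A k = gt_mat n d r B k * G" and G: "G \<in> carrier_mat (r k) (r k)"
    and i: "i \<in> index_set n d" and k: "k \<le> d"
    and A: "core_prod r A i k d \<in> carrier_mat (r k) 1"
    and B: "core_prod r B i k d \<in> carrier_mat (r k) 1"
  shows "core_prod r A i k d = G\<^sup>T * core_prod r B i k d"
proof (rule eq_matI)
  fix y x assume xy: "y < dim_row (G\<^sup>T * core_prod r B i k d)" "x < dim_col (G\<^sup>T * core_prod r B i k d)"
  then have [simp]: "x = 0" and y: "y < r k"
    using B G by auto
  have "core_prod r A i k d $$ (y, 0) = (gt_mat n d r B k * G) $$ (colex n k d i, y)"
    using gt_mat_colex [of i n d k y r A] i k y eq by simp
  also have "\<dots> = (\<Sum>z<r k. gt_mat n d r B k $$ (colex n k d i, z) * G $$ (z, y))"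
    using colex_less_right [OF i k] G y by (intro mult_mat_entry) auto
  also have "\<dots> = (\<Sum>z<r k. G\<^sup>T $$ (y, z) * core_prod r B i k d $$ (z, 0))"
    using G y by (intro sum.cong refl) (simp add: gt_mat_colex [OF i k])
  also have "\<dots> = (G\<^sup>T * core_prod r B i k d) $$ (y, 0)"
    using B G y by (intro mult_mat_entry [symmetric]) auto
  finally show "core_prod r A i k d $$ (y, x) = (G\<^sup>T * core_prod r B i k d) $$ (y, x)"
    by simp
qed (use A B G in auto)

text \<open>\<open>C_eq_USV\<close> expresses, without naming the tensor, that \<open>C\<close>
  represents the same one as the decompositions through \<open>U\<close>, \<open>S\<close> and
  \<open>V\<close>. The range \<open>{1..<d}\<close> consists of the cuts that have a middle factor
  \<open>S k\<close>.\<close>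

locale tt_gauge = tt_frames +
  fixes C :: "nat \<Rightarrow> core" and S :: "nat \<Rightarrow> real mat"
  assumes core_C: "k \<in> {1..d} \<Longrightarrow> is_core n r k (C k)"
    and S_carrier: "k \<in> {1..<d} \<Longrightarrow> S k \<in> carrier_mat (r k) (r k)"
    and S_invertible: "k \<in> {1..<d} \<Longrightarrow> invertible_mat (S k)"
    and C_eq_USV: "k \<in> {1..<d} \<Longrightarrow> i \<in> I \<Longrightarrow>
      core_prod r C i 0 d $$ (0, 0) = (core_prod r U i 0 k * S k * core_prod r V i k d) $$ (0, 0)"
begin

lemma C_prod:
  "i \<in> I \<Longrightarrow> j \<le> k \<Longrightarrow> k \<le> d \<Longrightarrow> core_prod r C i j k \<in> carrier_mat (r j) (r k)"
  using core_C by (intro core_prod_carrier core_slice_carrier) auto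

lemma row_carriers:
  assumes "i \<in> I"
  shows "k < d \<Longrightarrow> core_prod r U i 0 k \<in> carrier_mat 1 (r k)"
    "1 \<le> k \<Longrightarrow> k \<le> d \<Longrightarrow> core_prod r V i k d \<in> carrier_mat (r k) 1"
    "k \<le> d \<Longrightarrow> core_prod r C i 0 k \<in> carrier_mat 1 (r k)"
    "k \<le> d \<Longrightarrow> core_prod r C i k d \<in> carrier_mat (r k) 1"
  using U_prod [OF assms, of 0 k] V_prod [OF assms, of k d] C_prod [OF assms, of 0 k]
    C_prod [OF assms, of k d] r0 rd by auto

lemma unfolding_factorizations:
  assumes k: "k \<in> {1..<d}"
  shows "le_mat n r C k * (gt_mat n d r C k)\<^sup>T = le_mat n r U k * S k * (gt_mat n d r V k)\<^sup>T"
proof (rule eq_matI)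
  fix a b
  assume "a < dim_row (le_mat n r U k * S k * (gt_mat n d r V k)\<^sup>T)"
    "b < dim_col (le_mat n r U k * S k * (gt_mat n d r V k)\<^sup>T)"
  then have ab: "a < num_indices n 0 k" "b < num_indices n k d"
    by (simp_all add: le_mat_def gt_mat_def)
  define i where "i = join_index n d k a b"
  have i: "i \<in> I"
    using join_index_mem [OF ab] k by (simp add: i_def)
  have "core_prod r C i 0 d = core_prod r C i 0 k * core_prod r C i k d"
    using k i core_C by (intro core_prod_split core_slice_carrier) auto
  \<comment> \<open>The identity plays the part of the middle factor, so that one entry formula
    serves both factorizations.\<close>
  also have "\<dots> = core_prod r C i 0 k * 1\<^sub>m (r k) * core_prod r C i k d"
    using row_carriers [OF i, of k] k by simp
  finally have "core_prod r C i 0 d $$ (0, 0) =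
      (le_mat n r C k * 1\<^sub>m (r k) * (gt_mat n d r C k)\<^sup>T) $$ (a, b)"
    using unfolding_factorization_entry [OF ab _ i_def, of "1\<^sub>m (r k)" r C C] row_carriers [OF i, of k] k
    by simp
  moreover have "le_mat n r C k * 1\<^sub>m (r k) = le_mat n r C k"
    by (rule right_mult_one_mat [OF le_mat_carrier])
  moreover have "(core_prod r U i 0 k * S k * core_prod r V i k d) $$ (0, 0) =
      (le_mat n r U k * S k * (gt_mat n d r V k)\<^sup>T) $$ (a, b)"
    using unfolding_factorization_entry [OF ab _ i_def, of "S k" r U V] row_carriers [OF i, of k] k
      S_carrier [OF k] by simp
  ultimately show "(le_mat n r C k * (gt_mat n d r C k)\<^sup>T) $$ (a, b) =
      (le_mat n r U k * S k * (gt_mat n d r V k)\<^sup>T) $$ (a, b)"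
    using C_eq_USV [OF k i] by simp
qed (simp_all add: le_mat_def gt_mat_def)

text \<open>Both factorizations of the unfolding have inner dimension \<open>r k\<close>, so
  \<open>full_rank_factor_unique\<close> applies. At \<open>k = 0\<close> both products are empty
  and the gauge is the identity.\<close>

lemma left_gauge:
  assumes "k < d"
  obtains G G' where "G \<in> carrier_mat (r k) (r k)" "G' \<in> carrier_mat (r k) (r k)"
    "G * G' = 1\<^sub>m (r k)" "\<forall>i\<in>I. core_prod r C i 0 k = core_prod r U i 0 k * G"
proof (cases "k = 0")
  case True
  then show ?thesis
    using that [of "1\<^sub>m (r 0)" "1\<^sub>m (r 0)"] by simp
next
  case False
  then have k: "k \<in> {1..<d}" using assms by simp
  note inv = inv_mat_inverse [OF S_carrier [OF k] S_invertible [OF k]]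
  obtain G G' where "G \<in> carrier_mat (r k) (r k)" "G' \<in> carrier_mat (r k) (r k)"
    "G * G' = 1\<^sub>m (r k)" "le_mat n r C k = le_mat n r U k * G"
    using full_rank_factor_unique [OF le_mat_carrier gt_mat_carrier le_mat_carrier gt_mat_carrier
        S_carrier [OF k] inv(1,3) L_carrier L_inverse R_carrier R_inverse unfolding_factorizations [OF k]] k
    by auto
  then show ?thesis
    using k row_carriers by (intro that [of G G']) (auto intro!: core_prod_of_le_mat)
qed

lemma right_gauge:
  assumes "k \<in> {1..d}"
  obtains H H' where "H \<in> carrier_mat (r k) (r k)" "H' \<in> carrier_mat (r k) (r k)"
    "H' * H = 1\<^sub>m (r k)" "\<forall>i\<in>I. core_prod r C i k d = H * core_prod r V i k d"
proof (cases "k = d")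
  case True
  then show ?thesis
    using that [of "1\<^sub>m (r d)" "1\<^sub>m (r d)"] by simp
next
  case False
  then have k: "k \<in> {1..<d}" using assms by simp
  let ?C = "le_mat n r C k" and ?C' = "gt_mat n d r C k"
  let ?U = "le_mat n r U k" and ?V = "gt_mat n d r V k"
  let ?N = "num_indices n 0 k" and ?M = "num_indices n k d"
  note S = S_carrier [OF k]
  note inv = inv_mat_inverse [OF S S_invertible [OF k]]
  have inv_T: "(S k)\<^sup>T * (inv_mat (S k))\<^sup>T = 1\<^sub>m (r k)"
    using transpose_mult [OF inv(1) S] inv(2) by simp
  \<comment> \<open>Transposing the factorizations exchanges left and right frames, so the same
    uniqueness argument applies with \<open>(S k)\<^sup>T\<close> in the middle.\<close>
  have "?C' * ?C\<^sup>T = (?C * ?C'\<^sup>T)\<^sup>T"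
    by (simp add: transpose_mult [of _ ?N "r k" _ ?M])
  also have "\<dots> = ?V * (S k)\<^sup>T * ?U\<^sup>T"
  proof -
    have "?U * S k \<in> carrier_mat ?N (r k)"
      using S by (intro mult_carrier_mat) auto
    then show ?thesis
      unfolding unfolding_factorizations [OF k] using S
      by (simp add: transpose_mult [of _ ?N "r k" _ ?M] transpose_mult [of _ ?N "r k" _ "r k"]
          assoc_mult_mat [of _ ?M "r k" _ "r k" _ ?N])
  qed
  finally have eq: "?C' * ?C\<^sup>T = ?V * (S k)\<^sup>T * ?U\<^sup>T" .
  have S_T: "(S k)\<^sup>T \<in> carrier_mat (r k) (r k)" "(inv_mat (S k))\<^sup>T \<in> carrier_mat (r k) (r k)"
    using S inv(1) by auto
  have "k < d"
    using k by simp
  obtain G G' where G: "G \<in> carrier_mat (r k) (r k)" "G' \<in> carrier_mat (r k) (r k)"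
    "G * G' = 1\<^sub>m (r k)" "?C' = ?V * G"
    by (rule full_rank_factor_unique [OF gt_mat_carrier [of n d r C k] le_mat_carrier [of n r C k]
          gt_mat_carrier [of n d r V k] le_mat_carrier [of n r U k] S_T inv_T R_carrier [OF assms]
          R_inverse [OF assms] L_carrier [OF \<open>k < d\<close>] L_inverse [OF \<open>k < d\<close>] eq])
  \<comment> \<open>Transposition reverses the order; this is why the right gauge provides
    \<open>H' * H = 1\<^sub>m (r k)\<close>, the order needed to cancel on the right of a
    core.\<close>
  have "G'\<^sup>T * G\<^sup>T = 1\<^sub>m (r k)"
    using transpose_mult [OF G(1,2)] G(3) by simp
  then show ?thesis
    using k row_carriers G by (intro that [of "G\<^sup>T" "G'\<^sup>T"]) (auto intro!: core_prod_of_gt_mat)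
qed

text \<open>Passing from \<open>C\<close> to \<open>U\<close> and \<open>V\<close> turns the free
  core \<open>D m\<close> into \<open>G * D m * H\<close>. The gauge matrices are invertible, so
  this substitution reaches every core of the given size.\<close>

lemma T_eq_tt_summands:
  assumes j: "j \<in> {1..d}"
  shows "T j = {Z. \<exists>D. is_core n r j D \<and> Z = tt_summand n d r C C j D}"
proof -
  have "j - 1 < d"
    using j by auto
  then obtain G G' where G: "G \<in> carrier_mat (r (j - 1)) (r (j - 1))" "G' \<in> carrier_mat (r (j - 1)) (r (j - 1))"
    "G * G' = 1\<^sub>m (r (j - 1))"
    and CG: "\<forall>i\<in>I. core_prod r C i 0 (j - 1) = core_prod r U i 0 (j - 1) * G"
    by (rule left_gauge)
  obtain H H' where H: "H \<in> carrier_mat (r j) (r j)" "H' \<in> carrier_mat (r j) (r j)"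
    "H' * H = 1\<^sub>m (r j)"
    and CH: "\<forall>i\<in>I. core_prod r C i j d = H * core_prod r V i j d"
    using j by (rule right_gauge)
  have eq: "tt_summand n d r C C j D = tt_summand n d r U V j (\<lambda>m. G * D m * H)"
    if D: "is_core n r j D" for D
  proof
    fix i
    have "core_prod r U i 0 (j - 1) * G * D (i j) * (H * core_prod r V i j d) =
      core_prod r U i 0 (j - 1) * (G * D (i j) * H) * core_prod r V i j d" if i: "i \<in> I"
    proof -
      let ?p = "r (j - 1)" and ?q = "r j"
      have c: "core_prod r U i 0 (j - 1) \<in> carrier_mat 1 ?p" "core_prod r V i j d \<in> carrier_mat ?q 1"
        "D (i j) \<in> carrier_mat ?p ?q"
        using row_carriers(1) [OF i, of "j - 1"] row_carriers(2) [OF i, of j] j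
          core_slice_carrier [of n r j "\<lambda>_. D", OF D i j] by auto
      then show ?thesis
        using G(1) H(1)
        by (simp add: assoc_mult_mat [of _ 1 ?p _ ?p _ ?q] assoc_mult_mat [of _ 1 ?p _ ?q _ 1]
            assoc_mult_mat [of _ ?p ?q _ ?q _ 1] assoc_mult_mat [of _ ?p ?p _ ?q _ 1]
            assoc_mult_mat [of _ ?p ?p _ ?q _ ?q] assoc_mult_mat [of _ 1 ?p _ ?p _ 1]
            mult_carrier_mat [of _ ?p ?q _ ?q] mult_carrier_mat [of _ ?q ?q _ 1]
            mult_carrier_mat [of _ ?p ?p _ ?q] mult_carrier_mat [of _ ?p ?q _ 1])
    qed
    then show "tt_summand n d r C C j D i = tt_summand n d r U V j (\<lambda>m. G * D m * H) i"
      by (simp add: tt_summand_def CG [simplified] CH)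
  qed
  have core: "is_core n r j (\<lambda>m. A * D m * B)"
    if "is_core n r j D" "A \<in> carrier_mat (r (j - 1)) (r (j - 1))" "B \<in> carrier_mat (r j) (r j)" for A B D
    using that by (auto simp: is_core_def intro!: mult_carrier_mat)
  show ?thesis
  proof (intro equalityI subsetI CollectI)
    fix Z assume "Z \<in> T j"
    then obtain D where D: "is_core n r j D" "Z = tt_summand n d r U V j D"
      using T_imp_tt_summand [OF j] by metis
    let ?D = "\<lambda>m. G' * D m * H'"
    have D': "is_core n r j ?D"
      using D(1) G(2) H(2) by (rule core)
    \<comment> \<open>Slices are of prescribed size only for \<open>m < n j\<close>; this suffices,
      as \<open>tt_summand\<close> evaluates no other slice on the index set.\<close>
    have "G * (G' * D m * H') * H = D m" if "m < n j" for m
    proof -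
      have c: "D m \<in> carrier_mat (r (j - 1)) (r j)"
        using D(1) that by (simp add: is_core_def)
      have "G * (G' * D m * H') * H = (G * G') * D m * (H' * H)"
        using c G(1,2) H(1,2)
        by (simp add: assoc_mult_mat [of _ "r (j - 1)" "r (j - 1)" _ "r (j - 1)" _ "r j"]
            assoc_mult_mat [of _ "r (j - 1)" "r (j - 1)" _ "r j" _ "r j"]
            assoc_mult_mat [of _ "r (j - 1)" "r j" _ "r j" _ "r j"]
            mult_carrier_mat [of _ "r (j - 1)" "r j" _ "r j"]
            mult_carrier_mat [of _ "r (j - 1)" "r (j - 1)" _ "r j"]
            mult_carrier_mat [of _ "r j" "r j" _ "r j"])
      then show ?thesis
        using c G(3) H(3) by simp
    qed
    then have "tt_summand n d r U V j (\<lambda>m. G * ?D m * H) = Z"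
      unfolding D(2) tt_summand_def using j
      by (intro ext) (simp add: index_set_def PiE_iff)
    then have "tt_summand n d r C C j ?D = Z"
      using eq [OF D'] by simp
    then show "\<exists>D. is_core n r j D \<and> Z = tt_summand n d r C C j D"
      using D' by blast
  next
    fix Z assume "Z \<in> {Z. \<exists>D. is_core n r j D \<and> Z = tt_summand n d r C C j D}"
    then show "Z \<in> T j"
      using eq core [OF _ G(1) H(1)] tt_summand_in_T [OF j] by auto
  qed
qed

lemma TS_eq_tangent_space: "TS = tt_tangent_space n d r C"
proof (intro equalityI subsetI)
  fix Z assume "Z \<in> TS"
  then obtain X where X: "\<forall>k\<in>{1..d}. X k \<in> T k" "Z = (\<lambda>i. \<Sum>k = 1..d. X k i)"
    by (auto simp: TS_def)
  then have "\<forall>k\<in>{1..d}. \<exists>D. is_core n r k D \<and> X k = tt_summand n d r C C k D"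
    using T_eq_tt_summands by blast
  then obtain D where "\<forall>k\<in>{1..d}. is_core n r k (D k) \<and> X k = tt_summand n d r C C k (D k)"
    by (rule bchoice [THEN exE])
  with X(2) show "Z \<in> tt_tangent_space n d r C"
    using core_C by (auto simp: tt_tangent_space_eq intro!: exI [of _ D])
next
  fix Z assume "Z \<in> tt_tangent_space n d r C"
  then obtain D where "\<forall>k\<in>{1..d}. is_core n r k (D k)"
    "Z = (\<lambda>i. \<Sum>k = 1..d. tt_summand n d r C C k (D k) i)"
    using core_C by (auto simp: tt_tangent_space_eq)
  then show "Z \<in> TS"
    unfolding TS_def using T_eq_tt_summands
    by (intro CollectI exI [of _ "\<lambda>k. tt_summand n d r C C k (D k)"]) auto
qed

end

section \<open>Transfer to the oblique projectors of the statement\<close>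

lemma oblique_projector_onto_cong:
  assumes "\<And>Z. Z \<in> tensor_space n d \<Longrightarrow> P Z = P' Z"
    and "oblique_projector_onto (tensor_space n d) P' W"
  shows "oblique_projector_onto (tensor_space n d) P W"
proof -
  \<comment> \<open>The linearity clause compares the two maps at linear combinations, which must
    therefore be tensors again.\<close>
  have "(\<lambda>i. a * Z i + b * Z' i) \<in> tensor_space n d"
    if "Z \<in> tensor_space n d" "Z' \<in> tensor_space n d" for Z Z' a b
    using that by (simp add: tensor_space_def)
  then show ?thesis
    using assms unfolding oblique_projector_onto_def by (simp cong: image_cong)
qed

text \<open>Rebracketing exhibits both oblique projectors as a frame times a left inverse of it; the
  one for the right frames is the transpose of such a product.\<close>

lemma inv_mat_left_inverse:
  assumes X: "X \<in> carrier_mat p m" and U: "U \<in> carrier_mat p m" and inv: "invertible_mat (X\<^sup>T * U)"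
  shows "inv_mat (X\<^sup>T * U) * X\<^sup>T \<in> carrier_mat m p" "inv_mat (X\<^sup>T * U) * X\<^sup>T * U = 1\<^sub>m m"
    "proj_le_mat U X = U * (inv_mat (X\<^sup>T * U) * X\<^sup>T)"
    "proj_gt_mat U X = (U * (inv_mat (X\<^sup>T * U) * X\<^sup>T))\<^sup>T"
proof -
  have "X\<^sup>T * U \<in> carrier_mat m m"
    using X U by simp
  note W = inv_mat_inverse [OF this inv]
  let ?W = "inv_mat (X\<^sup>T * U)"
  show c: "?W * X\<^sup>T \<in> carrier_mat m p"
    using W(1) X by simp
  show "?W * X\<^sup>T * U = 1\<^sub>m m"
    using W X U by (simp add: assoc_mult_mat [of _ m m _ p _ m])
  show "proj_le_mat U X = U * (?W * X\<^sup>T)"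
    using W(1) X U by (simp add: proj_le_mat_def assoc_mult_mat [of _ p m _ m _ p])
  show "proj_gt_mat U X = (U * (?W * X\<^sup>T))\<^sup>T"
    unfolding transpose_mult [OF U c] using W(1) X transpose_mult [of ?W m m "X\<^sup>T" p]
    by (simp add: proj_gt_mat_def)
qed

theorem proposition4p1:
  fixes n r :: "nat \<Rightarrow> nat" and d :: nat
    and Y :: tensor and U V C :: "nat \<Rightarrow> core"
    and S Xle Xgt :: "nat \<Rightarrow> real mat"
  assumes "d \<ge> 2"
    and "Y \<in> tt_manifold n d r"
    and "orthogonal_decomposition n d r Y U V S"
    and "\<forall>k\<in>{1..d-1}. Xle k \<in> carrier_mat (num_indices n 0 k) (r k) \<and>
           invertible_mat ((Xle k)\<^sup>T * le_mat n r U k)"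
    and "\<forall>k\<in>{1..d-1}. Xgt k \<in> carrier_mat (num_indices n k d) (r k) \<and>
           invertible_mat ((Xgt k)\<^sup>T * gt_mat n d r V k)"
    and "tt_representation n d r Y C"
  shows "oblique_projector_onto (tensor_space n d) (P_tangent n d r U V Xle Xgt)
           (tt_tangent_space n d r C)"
proof -
  \<comment> \<open>At the ends, where no \<open>Xle\<close> or \<open>Xgt\<close> is given, the
    frames are the 1 by 1 identity, as \<open>triv\<close> below shows, and so are their left
    inverses.\<close>
  define L where "L k = (if k = 0 then 1\<^sub>m 1
    else inv_mat ((Xle k)\<^sup>T * le_mat n r U k) * (Xle k)\<^sup>T)" for k
  define R where "R k = (if k = d then 1\<^sub>m 1
    else inv_mat ((Xgt k)\<^sup>T * gt_mat n d r V k) * (Xgt k)\<^sup>T)" for k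
  \<comment> \<open>\<open>tt_rank\<close> has the value 1 at the two ends by definition.\<close>
  have r: "r 0 = 1" "r d = 1"
    using assms(1,2) by (auto simp: tt_manifold_def tt_rank_def)
  have Xle: "Xle k \<in> carrier_mat (num_indices n 0 k) (r k)"
    "invertible_mat ((Xle k)\<^sup>T * le_mat n r U k)" if "0 < k" "k < d" for k
    using assms(4) that by auto
  have Xgt: "Xgt k \<in> carrier_mat (num_indices n k d) (r k)"
    "invertible_mat ((Xgt k)\<^sup>T * gt_mat n d r V k)" if "0 < k" "k < d" for k
    using assms(5) that by auto
  note left = inv_mat_left_inverse [OF Xle(1) le_mat_carrier Xle(2)]
  note right = inv_mat_left_inverse [OF Xgt(1) gt_mat_carrier Xgt(2)]
  have triv: "le_mat n r U 0 = 1\<^sub>m 1" "gt_mat n d r V d = 1\<^sub>m 1"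
    using r by (auto simp: le_mat_def gt_mat_def num_indices_def)
  interpret tt_gauge n r d U V L R C S
  proof
    \<comment> \<open>The axiom that links the two sets of cores: \<open>Y i\<close> is evaluated
      once through \<open>C\<close> and once through the decomposition at \<open>k\<close>.\<close>
    fix k i assume k: "k \<in> {1..<d}" and i: "i \<in> index_set n d"
    have "Y i = core_prod r C i 0 d $$ (0, 0)"
      using assms(6) i by (simp add: tt_representation_def tt_tensor_def)
    moreover have "k \<in> {1..d-1}"
      using k by auto
    then have "Y i = (core_prod r U i 0 k * S k * core_prod r V i k d) $$ (0, 0)"
      using assms(3) i unfolding orthogonal_decomposition_def by blast
    ultimately show "core_prod r C i 0 d $$ (0, 0) =
        (core_prod r U i 0 k * S k * core_prod r V i k d) $$ (0, 0)"
      by simp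
  qed (use assms(3,6) r left right triv in
      \<open>auto simp: L_def R_def orthogonal_decomposition_def tt_representation_def num_indices_def\<close>)
  \<comment> \<open>For \<open>k = 0\<close> the left side is the identity by convention and the
    right side by \<open>PL_zero\<close>, which needs \<open>Z\<close> to be a tensor.\<close>
  have PL: "P_le n d r U Xle k Z = PL k Z" if "Z \<in> E" "k < d" for k Z
    using that left(3) [of k] PL_zero by (simp add: P_le_def PL_def L_def)
  have PR: "P_gt n d r V Xgt k Z = PR k Z" if "k \<in> {1..<d}" for k Z
    using that right(4) [of k] by (simp add: P_gt_def PR_def R_def)
  have "P_tangent n d r U V Xle Xgt Z = P Z" if "Z \<in> E" for Z
  proof
    fix i
    have "(\<Sum>k = 1..d-1. P_le n d r U Xle (k - 1) (P_gt n d r V Xgt k Z) i -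
        P_le n d r U Xle k (P_gt n d r V Xgt k Z) i) =
      (\<Sum>k = 1..d-1. PL (k - 1) (PR k Z) i - PL k (PR k Z) i)"
      by (intro sum.cong refl) (auto simp: PL PR)
    then show "P_tangent n d r U V Xle Xgt Z i = P Z i"
      using that assms(1) by (simp add: P_tangent_def P_def PL)
  qed
  moreover have "oblique_projector_onto E P (tt_tangent_space n d r C)"
    using P_projector assms(1) by (simp add: TS_eq_tangent_space)
  ultimately show ?thesis
    by (rule oblique_projector_onto_cong)
qed

end
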